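(* Let $\sigma>0$, $r>0$, $b>0$ be the parameters of the Lorenz system $$\dot x=\sigma(y-x),\qquad \dot y=rx-y-xz,\qquad \dot z=-bz+xy ,$$ and let $K$ be its global attractor. Assume that $$r-1>0\qquad\text{and}\qquad r-1\ \ge\ \frac{b(b+\sigma-1)^2-4\sigma(b+\sigma b-b^2)}{3\sigma^2},$$ and that at least one of the following two conditions (a), (b) holds: (a) $\ \sigma^2(r-1)(b-4)\le 4\sigma(\sigma b+b-b^2)-b(b+\sigma-1)^2$; (b) $\ \sigma^2(r-1)(b-4)> 4\sigma(\sigma b+b-b^2)-b(b+\sigma-1)^2$, the equation in $\gamma$ $$(2\sigma-b+\gamma)^2\Big(b(b+\sigma-1)^2-4\sigma(\sigma b+b-b^2)+\sigma^2(r-1)(b-4)\Big)+4b\gamma(\sigma+1)\Big(b(b+\sigma-1)^2-4\sigma(\sigma b+b-b^2)-3\sigma^2(r-1)\Big)=0$$ has two distinct real roots, and its greater root $\gamma^{(II)}$ satisfies $\gamma^{(II)}>0$. If moreover $\sigma r>(b+1)(b+\sigma)$, then $$\dim_L K\ =\ 3-\frac{2(\sigma+b+1)}{\sigma+1+\sqrt{(\sigma-1)^2+4\sigma r}} .$$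
   Context: The Lorenz system with positive parameters is dissipative and generates a dynamical system for $t\ge 0$: for each $x_0\in\mathbb{R}^3$ the solution $x(t,x_0)$ with $x(0,x_0)=x_0$ exists for all $t\ge 0$. It possesses a global attractor, i.e. a bounded closed invariant set which is globally attractive. Lyapunov dimension. For a system $\dot{x}=f(x)$ in $\mathbb{R}^n$ ($f$ smooth; here $n=3$), let $X(t,x_0)$ be the fundamental matrix of the linearization along $x(t,x_0)$, i.e. $\dot X(t,x_0)=J(x(t,x_0))X(t,x_0)$, $X(0,x_0)=I_n$, where $J$ is the Jacobian matrix of $f$. Let $s_1(t,x_0)\ge\dots\ge s_n(t,x_0)>0$ be the singular values of $X(t,x_0)$, and for $t>0$ put $\mathrm{LE}_i(t,x_0)=\frac1t\ln s_i(t,x_0)$. Define $\mathrm{LD}(t,x_0)=0$ if $\mathrm{LE}_1(t,x_0)\le 0$; $\mathrm{LD}(t,x_0)=n$ if $\sum_{i=1}^n\mathrm{LE}_i(t,x_0)\ge 0$; otherwise $$\mathrm{LD}(t,x_0)=j+\frac{\mathrm{LE}_1(t,x_0)+\dots+\mathrm{LE}_j(t,x_0)}{|\mathrm{LE}_{j+1}(t,x_0)|},$$ where $j=j(t,x_0)$ is the largest integer with $\mathrm{LE}_1(t,x_0)+\dots+\mathrm{LE}_j(t,x_0)\ge 0$ (then the fraction is automatically $<1$). The local Lyapunov dimension at $x_0$ is $\mathrm{LD}(x_0)=\limsup_{t\to+\infty}\mathrm{LD}(t,x_0)$, and the Lyapunov dimension of a compact invariant set $K$ is $\dim_L K=\sup_{x_0\in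 K}\mathrm{LD}(x_0)$. *)

theory Defs
  imports "HOL-Analysis.Analysis"
begin

text \<open>\<open>\<phi> t x\<close> is the value at time \<open>t\<close> of the solution starting in \<open>x\<close>; only \<open>t \<ge> 0\<close> is
  constrained, and the derivative at \<open>t = 0\<close> is one-sided.\<close>

definition solution_semiflow ::
  "('a::real_normed_vector \<Rightarrow> 'a) \<Rightarrow> (real \<Rightarrow> 'a \<Rightarrow> 'a) \<Rightarrow> bool" where
  "solution_semiflow f \<phi> \<longleftrightarrow>
     (\<forall>x. \<phi> 0 x = x \<and>
        (\<forall>t\<ge>0. ((\<lambda>s. \<phi> s x) has_vector_derivative f (\<phi> t x)) (at t within {0..})))"

definition invariant_set :: "(real \<Rightarrow> 'a \<Rightarrow> 'a) \<Rightarrow> 'a set \<Rightarrow> bool" where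
  "invariant_set \<phi> K \<longleftrightarrow> (\<forall>t\<ge>0. \<phi> t ` K = K)"

definition globally_attractive :: "(real \<Rightarrow> 'a::metric_space \<Rightarrow> 'a) \<Rightarrow> 'a set \<Rightarrow> bool" where
  "globally_attractive \<phi> K \<longleftrightarrow> (\<forall>x. ((\<lambda>t. infdist (\<phi> t x) K) \<longlongrightarrow> 0) at_top)"

text \<open>Attraction is required pointwise, not uniformly on bounded sets, so every uniformly
  attracting global attractor is included. Nonemptiness is stated explicitly because
  \<open>infdist x {} = 0\<close>.\<close>

definition global_attractor :: "(real \<Rightarrow> 'a::metric_space \<Rightarrow> 'a) \<Rightarrow> 'a set \<Rightarrow> bool" where
  "global_attractor \<phi> K \<longleftrightarrow>
     K \<noteq> {} \<and> bounded K \<and> closed K \<and> invariant_set \<phi> K \<and> globally_attractive \<phi> K"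

definition fundamental_matrix ::
  "(real^'n \<Rightarrow> real^'n) \<Rightarrow> (real \<Rightarrow> real^'n \<Rightarrow> real^'n) \<Rightarrow> (real \<Rightarrow> real^'n \<Rightarrow> real^'n^'n) \<Rightarrow> bool"
  where
  "fundamental_matrix f \<phi> X \<longleftrightarrow>
     (\<forall>x. X 0 x = mat 1 \<and>
        (\<forall>t\<ge>0. ((\<lambda>s. X s x) has_vector_derivative jacobian f (at (\<phi> t x)) ** X t x)
                 (at t within {0..})))"

text \<open>The nonincreasing list of the square roots of the eigenvalues of \<open>transpose A ** A\<close>,
  repeated according to multiplicity, i.e. as roots of the characteristic polynomial.\<close>

definition singular_values :: "real^'n^'n \<Rightarrow> real list" where
  "singular_values A =
     (THE s. length s = CARD('n) \<and> sorted_wrt (\<ge>) s \<and> (\<forall>u\<in>set s. 0 \<le> u) \<and>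
             (\<forall>x. det (mat x - transpose A ** A) = (\<Prod>u\<leftarrow>s. x - u\<^sup>2)))"

text \<open>Exponents are numbered from 1, list positions from 0.\<close>

definition lyapunov_exponent ::
  "(real \<Rightarrow> 'a \<Rightarrow> real^'n^'n) \<Rightarrow> nat \<Rightarrow> real \<Rightarrow> 'a \<Rightarrow> real" where
  "lyapunov_exponent X i t x = ln (singular_values (X t x) ! (i - 1)) / t"

definition finite_time_lyapunov_dim ::
  "(real \<Rightarrow> 'a \<Rightarrow> real^'n^'n) \<Rightarrow> real \<Rightarrow> 'a \<Rightarrow> real" where
  "finite_time_lyapunov_dim X t x =
     (let LE = (\<lambda>i. lyapunov_exponent X i t x); n = CARD('n);
          j = Max {j. j \<le> n \<and> (\<Sum>i=1..j. LE i) \<ge> 0}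
      in if LE 1 \<le> 0 then 0
         else if (\<Sum>i=1..n. LE i) \<ge> 0 then real n
         else real j + (\<Sum>i=1..j. LE i) / \<bar>LE (j + 1)\<bar>)"

definition local_lyapunov_dim :: "(real \<Rightarrow> 'a \<Rightarrow> real^'n^'n) \<Rightarrow> 'a \<Rightarrow> ereal" where
  "local_lyapunov_dim X x = Limsup at_top (\<lambda>t. ereal (finite_time_lyapunov_dim X t x))"

definition lyapunov_dim :: "(real \<Rightarrow> 'a \<Rightarrow> real^'n^'n) \<Rightarrow> 'a set \<Rightarrow> ereal" where
  "lyapunov_dim X K = (SUP x\<in>K. local_lyapunov_dim X x)"

definition lorenz :: "real \<Rightarrow> real \<Rightarrow> real \<Rightarrow> real^3 \<Rightarrow> real^3" where
  "lorenz \<sigma> r b v =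
     (let x = v $ 1; y = v $ 2; z = v $ 3
      in vector [\<sigma> * (y - x), r * x - y - x * z, - b * z + x * y])"

end

theory Submission
  imports Defs
begin

text \<open>The dimension at a point is governed by \<open>P = (ln s1 + ln s2) / t\<close>, the growth rate of the largest area
under the linearized flow. Indeed the divergence of the Lorenz field is the constant \<open>- c\<close> with
\<open>c = \<sigma> + 1 + b\<close>, so the three finite-time exponents sum to \<open>- c\<close>, and whenever \<open>P > 0\<close> the finite-time dimension equals
\<open>2 + P / (c + P)\<close>, which increases with \<open>P\<close> (\<open>finite_time_lyapunov_dim_3\<close>). The theorem therefore amounts to two
statements about areas. With \<open>D = sqrt ((\<sigma> - 1)\<^sup>2 + 4 * \<sigma> * r)\<close> and \<open>\<kappa> = (D - (\<sigma> + 1)) / 2 - b\<close>, no area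
grows faster than a constant times \<open>exp (\<kappa> * t)\<close> along an orbit in the attractor, and at the
origin some area grows that fast. The value \<open>2 + \<kappa> / (c + \<kappa>)\<close> is the claimed dimension, and
\<open>\<sigma> * r > (b + 1) * (b + \<sigma>)\<close> says that \<open>\<kappa>\<close> is positive.

Areas are handled through the cross products of the columns of the fundamental matrix. Each solves
the second compound equation, and the sum of their squared norms is the second
symmetric function of the squared singular values (\<open>singular_values_3\<close>), which is between
\<open>(s1 * s2)\<^sup>2\<close> and three times that.

The origin is an equilibrium, hence lies in the attractor. There the eigenvalues are \<open>- b\<close> and
\<open>(- (\<sigma> + 1) \<plusminus> D) / 2\<close>, the two largest of them sum to \<open>\<kappa>\<close>, and one component of a cross product
solves a scalar equation with exactly this rate (\<open>area_growth_at_origin\<close>).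

The upper bound is Leonov's Lyapunov function argument. After a constant linear change of coordinates the
growth rate of a cross product is bounded by half the square root of an explicit quadratic polynomial in the state,
minus a constant; linearizing the square root at its value at the origin bounds twice the rate by
\<open>2 * \<kappa>\<close> plus \<open>1 / (2 * D)\<close> times the polynomial \<open>k z\<^sup>2 - 4 \<sigma> z + k (y + m x)\<^sup>2\<close>
(\<open>compound_quadratic_form_rate\<close>). Under the parameter hypotheses there is a polynomial \<open>V\<close> whose
derivative along the flow is at most the negative of this polynomial
(\<open>lorenz_lyapunov_function\<close>). As \<open>V\<close> is bounded on the attractor, the
polynomial contributes only a bounded factor (\<open>area_growth_on_bounded_orbit\<close>).\<close>

unbundle cross3_syntax

section \<open>Singular values in dimension three\<close>

lemma det_mat_minus_3:
  fixes G :: "real^3^3"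
  obtains t1 t2 t3 where "\<And>x. det (mat x - G) = x^3 - t1 * x\<^sup>2 + t2 * x - t3"
proof
  fix x
  show "det (mat x - G) = x^3 - (G$1$1 + G$2$2 + G$3$3) * x\<^sup>2
      + (G$1$1 * G$2$2 - G$1$2 * G$2$1 + G$1$1 * G$3$3 - G$1$3 * G$3$1
         + G$2$2 * G$3$3 - G$2$3 * G$3$2) * x - det G"
    by (simp add: det_3 mat_def algebra_simps power2_eq_square power3_eq_cube)
qed

lemma monic_cubic_has_root:
  fixes t1 t2 t3 :: real
  obtains u where "u^3 - t1 * u\<^sup>2 + t2 * u - t3 = 0"
proof -
  \<comment> \<open>at \<open>- R\<close> and \<open>R\<close> the cubic term dominates the others\<close>
  define R where "R = 1 + \<bar>t1\<bar> + \<bar>t2\<bar> + \<bar>t3\<bar>"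
  have R1: "R \<ge> 1" by (simp add: R_def)
  have dom: "\<bar>t1\<bar> * R\<^sup>2 + \<bar>t2\<bar> * R + \<bar>t3\<bar> < R^3"
  proof -
    have "R \<le> R\<^sup>2" "1 \<le> R\<^sup>2" using R1 by (auto intro: self_le_power one_le_power)
    then have "\<bar>t2\<bar> * R \<le> \<bar>t2\<bar> * R\<^sup>2" "\<bar>t3\<bar> * 1 \<le> \<bar>t3\<bar> * R\<^sup>2"
      by (intro mult_left_mono; simp)+
    moreover have "\<bar>t1\<bar> * R\<^sup>2 + \<bar>t2\<bar> * R\<^sup>2 + \<bar>t3\<bar> * R\<^sup>2 = (R - 1) * R\<^sup>2"
      by (simp add: R_def algebra_simps)
    moreover have "(R - 1) * R\<^sup>2 < R^3"
      using R1 by (simp add: algebra_simps power2_eq_square power3_eq_cube)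
    ultimately show ?thesis by linarith
  qed
  have b: "- \<bar>t\<bar> * s \<le> t * s" "t * s \<le> \<bar>t\<bar> * s" if "s \<ge> 0" for t s :: real
    using that mult_right_mono[of "- \<bar>t\<bar>" t s] mult_right_mono[of t "\<bar>t\<bar>" s] by auto
  have b1: "- (\<bar>t1\<bar> * R\<^sup>2) \<le> t1 * R\<^sup>2" "t1 * R\<^sup>2 \<le> \<bar>t1\<bar> * R\<^sup>2"
    "- (\<bar>t2\<bar> * R) \<le> t2 * R" "t2 * R \<le> \<bar>t2\<bar> * R"
    using b[of "R\<^sup>2" t1] b[of R t2] R1 by auto
  define p where "p u = u^3 - t1 * u\<^sup>2 + t2 * u - t3" for u
  have "p (-R) \<le> 0" "0 \<le> p R"
    using dom b1 by (auto simp: p_def power3_eq_cube)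
  moreover have "\<forall>u. -R \<le> u \<and> u \<le> R \<longrightarrow> isCont p u"
    unfolding p_def by (auto intro!: continuous_intros)
  ultimately obtain u where "p u = 0"
    using IVT[of p "-R" 0 R] R1 by auto
  then show ?thesis using that by (simp add: p_def)
qed

lemma det_mat_minus_orthogonal_conj:
  fixes G P :: "real^'n^'n"
  assumes "orthogonal_matrix P"
  shows "det (mat x - transpose P ** G ** P) = det (mat x - G)"
proof -
  have m: "mat x = x *\<^sub>R (mat 1 :: real^'n^'n)"
    by (simp add: mat_def vec_eq_iff)
  have "transpose P ** mat x ** P = mat x"
    using assms unfolding m orthogonal_matrix_def
    by (simp add: matrix_scalar_ac flip: scalar_matrix_assoc)
  moreover have "transpose P ** (mat x - G) = transpose P ** mat x - transpose P ** G"
    by (vector matrix_matrix_mult_def sum_subtractf right_diff_distrib)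
  moreover have "(B - C) ** P = B ** P - C ** P" for B C :: "real^'n^'n"
    by (vector matrix_matrix_mult_def sum_subtractf left_diff_distrib)
  ultimately have "mat x - transpose P ** G ** P = transpose P ** (mat x - G) ** P"
    by simp
  moreover have "det P * det P = 1"
    using assms by (metis det_I det_mul det_transpose orthogonal_matrix_def)
  ultimately show ?thesis
    by (simp add: det_mul)
qed

text \<open>The cubic has a real root \<open>u\<close>, hence a unit eigenvector. Rotating that eigenvector onto the
first axis makes the matrix block diagonal without changing the characteristic polynomial, and
the remaining symmetric block with diagonal \<open>a, d\<close> and off-diagonal entry \<open>k\<close> has the
discriminant \<open>(a - d)\<^sup>2 + 4 * k\<^sup>2 \<ge> 0\<close>.\<close>

lemma symmetric_charpoly_splits_3:
  fixes G :: "real^3^3"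
  assumes sym: "transpose G = G"
  obtains y1 y2 y3 where "\<And>x. det (mat x - G) = (x - y1) * (x - y2) * (x - y3)"
proof -
  obtain t1 t2 t3 where "\<And>x. det (mat x - G) = x^3 - t1 * x\<^sup>2 + t2 * x - t3"
    using det_mat_minus_3 by blast
  moreover obtain u where "u^3 - t1 * u\<^sup>2 + t2 * u - t3 = 0"
    using monic_cubic_has_root by blast
  ultimately have "det (mat u - G) = 0" by simp
  then obtain v where v: "v \<noteq> 0" "(mat u - G) *v v = 0"
    by (metis invertible_det_nz invertible_left_inverse matrix_left_invertible_ker)
  have Gv: "G *v v = u *\<^sub>R v"
  proof -
    have "mat u *v v = u *\<^sub>R v"
      by (simp add: matrix_vector_mult_def mat_def vec_eq_iff if_distrib if_distribR cong: if_cong)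
    then show ?thesis using v(2) by (simp add: matrix_vector_mult_diff_rdistrib)
  qed
  define e where "e = v /\<^sub>R norm v"
  have e: "norm e = 1" "G *v e = u *\<^sub>R e"
    using v(1) Gv by (simp_all add: e_def scaleR_matrix_vector_assoc matrix_vector_mult_scaleR)
  obtain P :: "real^3^3" where P: "orthogonal_matrix P" "P *v axis 1 1 = e"
    using orthogonal_matrix_exists_basis[OF e(1)] by metis
  define H where "H = transpose P ** G ** P"
  have H1: "H *v axis 1 1 = u *\<^sub>R axis 1 1"
  proof -
    have "H *v axis 1 1 = transpose P *v (G *v (P *v axis 1 1))"
      by (simp add: H_def matrix_vector_mul_assoc matrix_mul_assoc)
    also have "\<dots> = u *\<^sub>R ((transpose P ** P) *v axis 1 1)"
      unfolding P(2) e(2) by (simp add: matrix_vector_mult_scaleR P(2) flip: matrix_vector_mul_assoc)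
    finally show ?thesis using P(1) by (simp add: orthogonal_matrix_def)
  qed
  have HT: "transpose H = H"
    by (simp add: H_def matrix_transpose_mul sym matrix_mul_assoc)
  have Hs: "H $ i $ j = H $ j $ i" for i j
    by (subst HT[symmetric]) (simp add: transpose_def)
  have "H $ i $ 1 = (u *\<^sub>R axis 1 1 :: real^3) $ i" for i
    using H1 by (simp add: matrix_vector_mult_basis column_def vec_eq_iff)
  then have Hc: "H $ 1 $ 1 = u" "H $ 2 $ 1 = 0" "H $ 3 $ 1 = 0"
    by (simp_all add: axis_def)
  define a d k where "a = H $ 2 $ 2" and "d = H $ 3 $ 3" and "k = H $ 3 $ 2"
  define D where "D = sqrt ((a - d)\<^sup>2 + 4 * k\<^sup>2)"
  have D2: "D\<^sup>2 = (a - d)\<^sup>2 + 4 * k\<^sup>2"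
    unfolding D_def by (rule real_sqrt_pow2) (intro add_nonneg_nonneg mult_nonneg_nonneg; simp)
  have "det (mat x - G) = (x - u) * (x - (a + d + D) / 2) * (x - (a + d - D) / 2)" for x
  proof -
    have "det (mat x - G) = det (mat x - H)"
      using det_mat_minus_orthogonal_conj[OF P(1)] by (simp add: H_def)
    also have "\<dots> = (x - u) * ((x - a) * (x - d) - k\<^sup>2)"
      using Hs[of 1 2] Hs[of 1 3] Hs[of 2 3]
      by (simp add: det_3 mat_def Hc a_def d_def k_def algebra_simps power2_eq_square)
    also have "(x - a) * (x - d) - k\<^sup>2 = (x - (a + d + D) / 2) * (x - (a + d - D) / 2)"
    proof -
      have "(x - (a + d + D) / 2) * (x - (a + d - D) / 2) = (x - (a + d) / 2)\<^sup>2 - D\<^sup>2 / 4"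
        by (simp add: field_simps power2_eq_square)
      also have "\<dots> = (x - a) * (x - d) - k\<^sup>2"
        unfolding D2 by (simp add: field_simps power2_eq_square)
      finally show ?thesis by simp
    qed
    finally show ?thesis by simp
  qed
  then show ?thesis using that by blast
qed

text \<open>The entries of the Gram matrix are inner products of columns, so by Lagrange's identity its
principal minors of order two are squared areas of the parallelograms spanned by pairs of columns.\<close>

lemma gram_charpoly_3:
  fixes A :: "real^3^3"
  shows "det (mat x - transpose A ** A) = x^3 - (\<Sum>i\<in>UNIV. (norm (column i A))\<^sup>2) * x\<^sup>2
     + ((norm (column 1 A \<times> column 2 A))\<^sup>2 + (norm (column 2 A \<times> column 3 A))\<^sup>2
        + (norm (column 3 A \<times> column 1 A))\<^sup>2) * x - (det A)\<^sup>2"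
proof -
  define G where "G = transpose A ** A"
  have Gs: "G $ i $ j = column i A \<bullet> column j A" for i j
    by (simp add: G_def matrix_matrix_mult_def transpose_def column_def inner_vec_def)
  have n: "(norm (u \<times> v))\<^sup>2 = (u \<bullet> u) * (v \<bullet> v) - (u \<bullet> v)\<^sup>2" for u v :: "real^3"
    using norm_cross_dot[of u v]
    by (simp add: power_mult_distrib flip: power2_norm_eq_inner) 
  have dG: "det G = (det A)\<^sup>2" 
    by (simp add: G_def det_mul power2_eq_square)
  have "det (mat x - G) = x^3 - (G$1$1 + G$2$2 + G$3$3) * x\<^sup>2
      + (G$1$1 * G$2$2 - G$1$2 * G$2$1 + G$1$1 * G$3$3 - G$1$3 * G$3$1
         + G$2$2 * G$3$3 - G$2$3 * G$3$2) * x - det G"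
    by (simp add: det_3 mat_def algebra_simps power2_eq_square power3_eq_cube)
  then show ?thesis
    unfolding G_def[symmetric] dG n Gs
    by (simp only: sum_3 power2_norm_eq_inner) (simp add: inner_commute power2_eq_square algebra_simps)
qed

lemma sorted_roots_unique_3:
  fixes a b c a' b' c' :: real
  assumes eq: "\<And>x. (x - a) * (x - b) * (x - c) = (x - a') * (x - b') * (x - c')"
    and ord: "a \<ge> b" "b \<ge> c" "a' \<ge> b'" "b' \<ge> c'"
  shows "a = a' \<and> b = b' \<and> c = c'"
proof -
  have "a = a' \<or> a = b' \<or> a = c'" "a' = a \<or> a' = b \<or> a' = c"
    using eq[of a] eq[of a'] by auto
  then have a: "a = a'" using ord by auto
  have "c = a' \<or> c = b' \<or> c = c'" "c' = a \<or> c' = b \<or> c' = c"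
    using eq[of c] eq[of c'] by auto
  then have c: "c = c'" using ord by auto
  \<comment> \<open>to the right of all roots the factors for \<open>a\<close> and \<open>c\<close> are nonzero and can be cancelled\<close>
  have "(a + 1 - b) * (a + 1 - c) = (a + 1 - b') * (a + 1 - c)"
    using eq[of "a + 1"] a c by simp
  then have "b = b'" using ord by auto
  with a c show ?thesis by simp
qed

text \<open>Comparing coefficients in the Gram polynomial yields the two symmetric functions of the singular
values that enter the dimension: their product, and the sum of the squares of the pairwise
products as a sum of squared areas. The latter makes \<open>s1 * s2\<close> computable, up to a factor
\<open>sqrt 3\<close>, without knowing the singular values themselves.\<close>

lemma singular_values_3:
  fixes A :: "real^3^3"
  obtains s1 s2 s3 where "singular_values A = [s1, s2, s3]" "s1 \<ge> s2" "s2 \<ge> s3" "s3 \<ge> 0"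
    "s1 * s2 * s3 = \<bar>det A\<bar>"
    "(s1 * s2)\<^sup>2 + (s2 * s3)\<^sup>2 + (s3 * s1)\<^sup>2 = (norm (column 1 A \<times> column 2 A))\<^sup>2
       + (norm (column 2 A \<times> column 3 A))\<^sup>2 + (norm (column 3 A \<times> column 1 A))\<^sup>2"
proof -
  define p where "p x = det (mat x - transpose A ** A)" for x
  define t1 where "t1 = (\<Sum>i\<in>UNIV. (norm (column i A))\<^sup>2)"
  define t2 where "t2 = (norm (column 1 A \<times> column 2 A))\<^sup>2
       + (norm (column 2 A \<times> column 3 A))\<^sup>2 + (norm (column 3 A \<times> column 1 A))\<^sup>2"
  have p: "p x = x^3 - t1 * x\<^sup>2 + t2 * x - (det A)\<^sup>2" for x
    unfolding p_def t1_def t2_def by (rule gram_charpoly_3)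
  have t: "t1 \<ge> 0" "t2 \<ge> 0" by (auto simp: t1_def t2_def intro!: sum_nonneg)
  obtain y1 y2 y3 where y: "\<And>x. p x = (x - y1) * (x - y2) * (x - y3)"
    using symmetric_charpoly_splits_3[of "transpose A ** A"] matrix_transpose_mul[of "transpose A" A]
    unfolding p_def by auto
  have nonneg: "u \<ge> 0" if "p u = 0" for u
  proof (rule ccontr)
    assume "\<not> u \<ge> 0"
    then have "u^3 < 0" "t1 * u\<^sup>2 \<ge> 0" "t2 * u \<le> 0"
      using t by (auto simp: mult_nonneg_nonpos)
    then show False using that unfolding p using zero_le_power2[of "det A"] by linarith
  qed
  obtain z1 z2 z3 where z: "\<And>x. p x = (x - z1) * (x - z2) * (x - z3)" "z1 \<ge> z2" "z2 \<ge> z3"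
  proof -
    consider "y1 \<ge> y2" "y2 \<ge> y3" | "y1 \<ge> y3" "y3 \<ge> y2" | "y2 \<ge> y1" "y1 \<ge> y3"
      | "y2 \<ge> y3" "y3 \<ge> y1" | "y3 \<ge> y1" "y1 \<ge> y2" | "y3 \<ge> y2" "y2 \<ge> y1" by linarith
    then show ?thesis
    proof cases
      case 1 then show ?thesis using that[of y1 y2 y3] y by (simp add: mult_ac)
    next
      case 2 then show ?thesis using that[of y1 y3 y2] y by (simp add: mult_ac)
    next
      case 3 then show ?thesis using that[of y2 y1 y3] y by (simp add: mult_ac)
    next
      case 4 then show ?thesis using that[of y2 y3 y1] y by (simp add: mult_ac)
    next
      case 5 then show ?thesis using that[of y3 y1 y2] y by (simp add: mult_ac)
    next
      case 6 then show ?thesis using that[of y3 y2 y1] y by (simp add: mult_ac)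
    qed
  qed
  have z0: "z3 \<ge> 0" using nonneg z(1) by simp
  define s1 s2 s3 where "s1 = sqrt z1" and "s2 = sqrt z2" and "s3 = sqrt z3"
  have sq: "s1\<^sup>2 = z1" "s2\<^sup>2 = z2" "s3\<^sup>2 = z3"
    using z z0 by (auto simp: s1_def s2_def s3_def)
  have ord: "s1 \<ge> s2" "s2 \<ge> s3" "s3 \<ge> 0"
    using z z0 by (auto simp: s1_def s2_def s3_def)
  have "singular_values A = [s1, s2, s3]"
    unfolding singular_values_def p_def[symmetric]
  proof (rule the_equality)
    show "length [s1, s2, s3] = CARD(3) \<and> sorted_wrt (\<ge>) [s1, s2, s3] \<and> (\<forall>u\<in>set [s1, s2, s3]. 0 \<le> u)
      \<and> (\<forall>x. p x = (\<Prod>u\<leftarrow>[s1, s2, s3]. x - u\<^sup>2))"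
      using ord by (auto simp: z(1) sq)
  next
    fix s assume s: "length s = CARD(3) \<and> sorted_wrt (\<ge>) s \<and> (\<forall>u\<in>set s. 0 \<le> u)
      \<and> (\<forall>x. p x = (\<Prod>u\<leftarrow>s. x - u\<^sup>2))"
    then obtain a b c where abc: "s = [a, b, c]"
      by (auto simp: length_Suc_conv numeral_3_eq_3)
    have o: "a \<ge> b" "b \<ge> c" "c \<ge> 0" using s abc by auto
    have "(x - z1) * (x - z2) * (x - z3) = (x - a\<^sup>2) * (x - b\<^sup>2) * (x - c\<^sup>2)" for x
      using s z(1)[of x] by (simp add: abc)
    from sorted_roots_unique_3[OF this] have "z1 = a\<^sup>2 \<and> z2 = b\<^sup>2 \<and> z3 = c\<^sup>2"
      using z o by (auto intro!: power_mono)
    then show "s = [s1, s2, s3]"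
      using o by (simp add: abc s1_def s2_def s3_def)
  qed
  moreover have co: "z1 * z2 * z3 = (det A)\<^sup>2" "z1 * z2 + z2 * z3 + z3 * z1 = t2"
  proof -
    show 1: "z1 * z2 * z3 = (det A)\<^sup>2" using p[of 0] z(1)[of 0] by simp
    \<comment> \<open>evaluation at \<open>1\<close> and \<open>-1\<close>: the difference isolates the coefficient of \<open>x\<close>\<close>
    have "t2 + 1 - t1 - (det A)\<^sup>2 = (1 - z1) * (1 - z2) * (1 - z3)"
      "- t2 - 1 - t1 - (det A)\<^sup>2 = (-1 - z1) * (-1 - z2) * (-1 - z3)"
      using p[of 1] z(1)[of 1] p[of "-1"] z(1)[of "-1"] by simp_all
    then show "z1 * z2 + z2 * z3 + z3 * z1 = t2"
      by (simp add: algebra_simps)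
  qed
  moreover have "s1 * s2 * s3 = \<bar>det A\<bar>"
  proof -
    have "(s1 * s2 * s3)\<^sup>2 = \<bar>det A\<bar>\<^sup>2" using co by (simp add: power_mult_distrib sq)
    moreover have "s1 * s2 * s3 \<ge> 0" using ord by simp
    ultimately show ?thesis by (rule power2_eq_imp_eq) simp
  qed
  ultimately show ?thesis
    using ord that[of s1 s2 s3] by (simp add: t2_def power_mult_distrib sq)
qed

section \<open>Differential inequalities on the half-line\<close>

text \<open>The function \<open>f s * exp (- k * s)\<close> has a nonpositive derivative. The derivatives are
one-sided at \<open>0\<close>, as in the definition of a solution semiflow, so the mean value argument uses
interior points only.\<close>

lemma gronwall_on_half_line:
  fixes f f' :: "real \<Rightarrow> real"
  assumes der: "\<And>t. t \<ge> 0 \<Longrightarrow> (f has_real_derivative f' t) (at t within {0..})"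
    and le: "\<And>t. t \<ge> 0 \<Longrightarrow> f' t \<le> k * f t"
    and t: "t \<ge> 0"
  shows "f t \<le> f 0 * exp (k * t)"
proof -
  define g where "g s = f s * exp (- (k * s))" for s
  have dg: "(g has_real_derivative (f' s - k * f s) * exp (- (k * s))) (at s within {0..})"
    if "s \<ge> 0" for s
    unfolding g_def using that
    by (auto intro!: derivative_eq_intros der simp: algebra_simps)
  have "g 0 \<ge> g t"
  proof (rule DERIV_nonpos_imp_decreasing_open[OF t])
    fix s assume s: "0 < s" "s < t"
    have "at s within {0..} = at s"
      using s by (intro at_within_interior) (simp add: interior_real_atLeast)
    then have "(g has_real_derivative (f' s - k * f s) * exp (- (k * s))) (at s)"
      using dg[of s] s by simp
    moreover have "(f' s - k * f s) * exp (- (k * s)) \<le> 0"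
      using le[of s] s by (simp add: mult_nonpos_nonneg)
    ultimately show "\<exists>y. (g has_real_derivative y) (at s) \<and> y \<le> 0" by blast
  next
    have "continuous_on {0..} g"
      using dg by (auto simp: continuous_on_eq_continuous_within intro: DERIV_continuous)
    then show "continuous_on {0..t} g"
      by (rule continuous_on_subset) auto
  qed
  then have "g t * exp (k * t) \<le> g 0 * exp (k * t)" by simp
  moreover have "exp (- (k * t)) * exp (k * t) = 1" by (simp flip: exp_add)
  then have "g t * exp (k * t) = f t" by (simp add: g_def mult.assoc)
  ultimately have "f t \<le> g 0 * exp (k * t)" by linarith
  then show ?thesis by (simp add: g_def)
qed

lemma linear_ode_on_half_line:
  fixes f :: "real \<Rightarrow> real"
  assumes der: "\<And>t. t \<ge> 0 \<Longrightarrow> (f has_real_derivative k * f t) (at t within {0..})"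
    and t: "t \<ge> 0"
  shows "f t = f 0 * exp (k * t)"
proof (rule antisym)
  show "f t \<le> f 0 * exp (k * t)"
    by (rule gronwall_on_half_line[OF der _ t]) auto
  have "- f t \<le> - f 0 * exp (k * t)"
    by (rule gronwall_on_half_line[where f = "\<lambda>t. - f t" and f' = "\<lambda>t. - (k * f t)", OF _ _ t])
      (auto intro!: derivative_eq_intros der)
  then show "f 0 * exp (k * t) \<le> f t" by simp
qed

section \<open>Lyapunov dimension in terms of the growth of areas\<close>

text \<open>Since the three exponents sum to \<open>- c < 0\<close>, the first two sums decide everything. If
\<open>P = LE 1 + LE 2\<close> is positive, then the cut-off index is \<open>2\<close> and \<open>LE 3 = - (c + P)\<close>, so that the
dimension is a function of \<open>P\<close> alone; otherwise the dimension is at most \<open>2\<close>.\<close>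

lemma finite_time_lyapunov_dim_3:
  fixes X :: "real \<Rightarrow> 'a \<Rightarrow> real^3^3"
  assumes sv: "singular_values (X t x) = [s1, s2, s3]"
    and ord: "s1 \<ge> s2" "s2 \<ge> s3" "s3 > 0"
    and vol: "s1 * s2 * s3 = exp (- c * t)" and c: "c > 0" and t: "t > 0"
    and P: "P = ln (s1 * s2) / t"
  shows "P > 0 \<Longrightarrow> finite_time_lyapunov_dim X t x = 2 + P / (c + P)"
    and "P \<le> 0 \<Longrightarrow> finite_time_lyapunov_dim X t x \<le> 2"
proof -
  define LE where "LE i = lyapunov_exponent X i t x" for i
  have LE: "LE 1 = ln s1 / t" "LE 2 = ln s2 / t" "LE 3 = ln s3 / t"
    by (simp_all add: LE_def lyapunov_exponent_def sv)
  have s0: "s1 > 0" "s2 > 0" using ord by auto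
  have o: "LE 1 \<ge> LE 2" "LE 2 \<ge> LE 3"
    unfolding LE using ord t by (auto intro!: divide_right_mono)
  have P2: "LE 1 + LE 2 = P"
    unfolding LE P using s0 by (simp add: ln_mult add_divide_distrib)
  have P3: "LE 1 + LE 2 + LE 3 = - c"
  proof -
    have "ln s1 + ln s2 + ln s3 = ln (s1 * s2 * s3)"
      using ord s0 by (simp add: ln_mult)
    also have "\<dots> = - c * t" unfolding vol by simp
    finally show ?thesis unfolding LE using t by (simp add: field_simps)
  qed
  have sums: "(\<Sum>i=1..0. LE i) = 0" "(\<Sum>i=1..1. LE i) = LE 1" "(\<Sum>i=1..2. LE i) = P"
    "(\<Sum>i=1..3. LE i) = - c"
    using P2 P3 by (simp_all add: numeral_2_eq_2 numeral_3_eq_3 del: One_nat_def)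
      (simp_all add: numeral_2_eq_2 numeral_3_eq_3)
  define J where "J = {j. j \<le> (3::nat) \<and> (\<Sum>i=1..j. LE i) \<ge> 0}"
  have J: "j \<in> J \<longleftrightarrow> j = 0 \<or> j = 1 \<and> LE 1 \<ge> 0 \<or> j = 2 \<and> P \<ge> 0" for j
  proof -
    have "j \<le> 3 \<longleftrightarrow> j = 0 \<or> j = 1 \<or> j = 2 \<or> j = 3" by linarith
    then show ?thesis unfolding J_def using sums c by auto
  qed
  have fin: "finite J" by (auto simp: J_def)
  have dim: "finite_time_lyapunov_dim X t x =
     (if LE 1 \<le> 0 then 0 else real (Max J) + (\<Sum>i=1..Max J. LE i) / \<bar>LE (Max J + 1)\<bar>)"
    unfolding finite_time_lyapunov_dim_def Let_def LE_def[symmetric] J_def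
    using sums(4) c by simp
  show "finite_time_lyapunov_dim X t x = 2 + P / (c + P)" if "P > 0"
  proof -
    have "Max J = 2" using that fin J by (intro Max_eqI) auto
    moreover have "LE 3 = - (c + P)" using P2 P3 by simp
    moreover have "LE 1 > 0" using o P2 that by linarith
    ultimately show ?thesis unfolding dim using sums that c by (simp add: abs_if)
  qed
  show "finite_time_lyapunov_dim X t x \<le> 2" if "P \<le> 0"
  proof (cases "LE 1 \<le> 0")
    case True then show ?thesis by (simp add: dim)
  next
    case False
    show ?thesis
    proof (cases "P = 0")
      case True
      then have "Max J = 2" using fin J by (intro Max_eqI) auto
      then show ?thesis unfolding dim using sums True by simp
    next
      case neq: False
      then have "Max J = 1" using that False fin J by (intro Max_eqI) auto
      moreover have "LE 1 / \<bar>LE 2\<bar> \<le> 1"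
      proof -
        have "LE 1 \<le> \<bar>LE 2\<bar>" using P2 that False by linarith
        then show ?thesis by (simp add: divide_le_eq_1)
      qed
      ultimately show ?thesis unfolding dim using sums False
        by (simp add: numeral_2_eq_2)
    qed
  qed
qed

lemma divide_shift_mono:
  fixes c p q :: real
  assumes "c > 0" "p > 0" "p \<le> q"
  shows "p / (c + p) \<le> q / (c + q)"
proof -
  have "p * (c + q) \<le> q * (c + p)"
    using assms mult_left_mono[OF assms(3), of c] by (simp add: algebra_simps)
  then show ?thesis using assms by (simp add: frac_le_eq divide_simps algebra_simps)
qed

lemma dim_fraction_tendsto:
  fixes c \<kappa> C :: real
  assumes "c > 0" "\<kappa> > 0"
  shows "((\<lambda>t. 2 + (\<kappa> + C / t) / (c + (\<kappa> + C / t))) \<longlongrightarrow> 2 + \<kappa> / (c + \<kappa>)) at_top"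
proof -
  have "((\<lambda>t. \<kappa> + C / t) \<longlongrightarrow> \<kappa> + 0) at_top"
    by (intro tendsto_intros real_tendsto_divide_at_top[OF tendsto_const filterlim_ident])
  then show ?thesis using assms by (intro tendsto_intros) auto
qed

text \<open>A constant factor in the bound for \<open>s1 * s2\<close> shifts the exponent sum by \<open>ln C / t\<close>, which
vanishes in the limit. The function \<open>p / (c + p)\<close> is increasing, so bounds for the exponent sum
pass to the dimension.\<close>

lemma local_lyapunov_dim_le_3:
  fixes X :: "real \<Rightarrow> 'a \<Rightarrow> real^3^3"
  assumes sv: "\<And>t. t > 0 \<Longrightarrow> \<exists>s1 s2 s3. singular_values (X t x) = [s1, s2, s3] \<and> s1 \<ge> s2 \<and> s2 \<ge> s3
       \<and> s3 \<ge> 0 \<and> s1 * s2 * s3 = exp (- c * t) \<and> s1 * s2 \<le> C * exp (\<kappa> * t)"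
    and c: "c > 0" and \<kappa>: "\<kappa> > 0"
  shows "local_lyapunov_dim X x \<le> ereal (2 + \<kappa> / (c + \<kappa>))"
proof -
  \<comment> \<open>with a constant at least \<open>1\<close> the bounding rate is positive at all times\<close>
  define C' where "C' = max C 1"
  have C1: "C' \<ge> 1" "C \<le> C'" by (auto simp: C'_def)
  define g where "g t = 2 + (\<kappa> + ln C' / t) / (c + (\<kappa> + ln C' / t))" for t
  have "finite_time_lyapunov_dim X t x \<le> g t" if t: "t > 0" for t
  proof -
    obtain s1 s2 s3 where s: "singular_values (X t x) = [s1, s2, s3]" "s1 \<ge> s2" "s2 \<ge> s3" "s3 \<ge> 0"
      "s1 * s2 * s3 = exp (- c * t)" "s1 * s2 \<le> C * exp (\<kappa> * t)"
      using sv[OF t] by blast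
    have "s3 \<noteq> 0" using s(5) by auto
    then have s3: "s3 > 0" using s(4) by simp
    define P where "P = ln (s1 * s2) / t"
    have q: "\<kappa> + ln C' / t > 0" using \<kappa> C1 t by (simp add: add_pos_nonneg)
    have "s1 * s2 \<le> C' * exp (\<kappa> * t)"
      using s(6) mult_right_mono[OF C1(2) exp_ge_zero] by (rule order_trans)
    moreover have "s1 * s2 > 0" using s s3 by auto
    ultimately have "ln (s1 * s2) \<le> ln (C' * exp (\<kappa> * t))" by simp
    also have "\<dots> = ln C' + \<kappa> * t" using C1 by (simp add: ln_mult)
    finally have "P \<le> (ln C' + \<kappa> * t) / t" using t by (simp add: P_def divide_right_mono)
    then have P: "P \<le> \<kappa> + ln C' / t" using t by (simp add: add_divide_distrib)
    note d = finite_time_lyapunov_dim_3[where X = X and t = t and x = x, OF s(1-3) s3 s(5) c t P_def]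
    show ?thesis
    proof (cases "P > 0")
      case True
      have "P / (c + P) \<le> (\<kappa> + ln C' / t) / (c + (\<kappa> + ln C' / t))"
        using True c P by (intro divide_shift_mono) auto
      then show ?thesis using d(1)[OF True] by (simp add: g_def)
    next
      case False
      then have "finite_time_lyapunov_dim X t x \<le> 2" using d(2) by simp
      also have "2 \<le> g t" using q c by (simp add: g_def)
      finally show ?thesis .
    qed
  qed
  then have "eventually (\<lambda>t. ereal (finite_time_lyapunov_dim X t x) \<le> ereal (g t)) at_top"
    by (auto intro: eventually_mono[OF eventually_gt_at_top[of 0]])
  then have "local_lyapunov_dim X x \<le> Limsup at_top (\<lambda>t. ereal (g t))"
    unfolding local_lyapunov_dim_def by (rule Limsup_mono)
  also have "((\<lambda>t. ereal (g t)) \<longlongrightarrow> ereal (2 + \<kappa> / (c + \<kappa>))) at_top"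
    unfolding g_def using dim_fraction_tendsto[OF c \<kappa>] by simp
  then have "Limsup at_top (\<lambda>t. ereal (g t)) = ereal (2 + \<kappa> / (c + \<kappa>))"
    by (intro lim_imp_Limsup) auto
  finally show ?thesis .
qed

lemma local_lyapunov_dim_ge_3:
  fixes X :: "real \<Rightarrow> 'a \<Rightarrow> real^3^3"
  assumes sv: "\<And>t. t > 0 \<Longrightarrow> \<exists>s1 s2 s3. singular_values (X t x) = [s1, s2, s3] \<and> s1 \<ge> s2 \<and> s2 \<ge> s3
       \<and> s3 \<ge> 0 \<and> s1 * s2 * s3 = exp (- c * t) \<and> C * exp (\<kappa> * t) \<le> s1 * s2"
    and c: "c > 0" and \<kappa>: "\<kappa> > 0" and C: "C > 0"
  shows "ereal (2 + \<kappa> / (c + \<kappa>)) \<le> local_lyapunov_dim X x"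
proof -
  define g where "g t = 2 + (\<kappa> + ln C / t) / (c + (\<kappa> + ln C / t))" for t
  have le: "g t \<le> finite_time_lyapunov_dim X t x" if t: "t > 0" and q: "\<kappa> + ln C / t > 0" for t
  proof -
    obtain s1 s2 s3 where s: "singular_values (X t x) = [s1, s2, s3]" "s1 \<ge> s2" "s2 \<ge> s3" "s3 \<ge> 0"
      "s1 * s2 * s3 = exp (- c * t)" "C * exp (\<kappa> * t) \<le> s1 * s2"
      using sv[OF t] by blast
    have "s3 \<noteq> 0" using s(5) by auto
    then have s3: "s3 > 0" using s(4) by simp
    define P where "P = ln (s1 * s2) / t"
    have "ln C + \<kappa> * t = ln (C * exp (\<kappa> * t))" using C by (simp add: ln_mult)
    also have "\<dots> \<le> ln (s1 * s2)" using s s3 C by (subst ln_le_cancel_iff) auto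
    finally have "(ln C + \<kappa> * t) / t \<le> P" using t by (simp add: P_def divide_right_mono)
    then have P: "\<kappa> + ln C / t \<le> P" using t by (simp add: add_divide_distrib)
    note d = finite_time_lyapunov_dim_3[where X = X and t = t and x = x, OF s(1-3) s3 s(5) c t P_def]
    have "(\<kappa> + ln C / t) / (c + (\<kappa> + ln C / t)) \<le> P / (c + P)"
      using P q c by (intro divide_shift_mono) auto
    then show ?thesis using d(1) P q by (simp add: g_def)
  qed
  have "((\<lambda>t. \<kappa> + ln C / t) \<longlongrightarrow> \<kappa> + 0) at_top"
    by (intro tendsto_intros real_tendsto_divide_at_top[OF tendsto_const filterlim_ident])
  then have "eventually (\<lambda>t. \<kappa> + ln C / t > 0) at_top"
    using \<kappa> by (intro order_tendstoD(1)[where y = "\<kappa> + 0"]) auto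
  then have ev: "eventually (\<lambda>t. ereal (g t) \<le> ereal (finite_time_lyapunov_dim X t x)) at_top"
    using eventually_gt_at_top[of 0] by eventually_elim (simp add: le)
  have "((\<lambda>t. ereal (g t)) \<longlongrightarrow> ereal (2 + \<kappa> / (c + \<kappa>))) at_top"
    unfolding g_def using dim_fraction_tendsto[OF c \<kappa>] by simp
  then have "ereal (2 + \<kappa> / (c + \<kappa>)) = Limsup at_top (\<lambda>t. ereal (g t))"
    by (intro lim_imp_Limsup[symmetric]) auto
  also have "\<dots> \<le> local_lyapunov_dim X x"
    unfolding local_lyapunov_dim_def using ev by (rule Limsup_mono)
  finally show ?thesis .
qed

section \<open>Algebra behind the Lyapunov function\<close>

lemma negative_quadratic_form:
  fixes A B C u z :: real
  assumes "A \<ge> 0" "B \<ge> 0" "C\<^sup>2 \<le> 4 * A * B"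
  shows "- A * u\<^sup>2 + C * u * z - B * z\<^sup>2 \<le> 0"
proof (cases "A = 0")
  case True
  with assms have "C = 0" by simp
  with True assms show ?thesis by simp
next
  case False
  have "4 * A * (- A * u\<^sup>2 + C * u * z - B * z\<^sup>2) = (C\<^sup>2 - 4 * A * B) * z\<^sup>2 - (2 * A * u - C * z)\<^sup>2"
    by algebra
  also have "\<dots> \<le> 0"
  proof -
    have "(C\<^sup>2 - 4 * A * B) * z\<^sup>2 \<le> 0"
      using assms(3) by (simp add: mult_nonpos_nonneg)
    then show ?thesis using zero_le_power2[of "2 * A * u - C * z"] by linarith
  qed
  finally show ?thesis using False assms by (simp add: mult_le_0_iff)
qed

text \<open>The first three summands are the derivative along the Lorenz flow of
\<open>V = \<alpha> x\<^sup>4 + \<beta> x\<^sup>2 z + \<delta> y\<^sup>2 + \<epsilon> z\<^sup>2 + \<zeta> x y + \<eta> x\<^sup>2 + \<theta> z\<close>. The coefficients are chosen as follows.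
\<open>\<theta>\<close> cancels the linear term in \<open>z\<close>; \<open>\<alpha>\<close> and \<open>\<epsilon>\<close> cancel \<open>x\<^sup>3 y\<close> and \<open>x y z\<close>. What remains
splits into a form in \<open>(x\<^sup>2, z)\<close> and a form in \<open>(x, y)\<close>. The free parameter \<open>\<eta>\<close> moves weight between \<open>x\<^sup>2\<close>
and \<open>x y\<close>, keeping the value of the second form at \<open>x = y = 1\<close>; that value is made zero by
\<open>2 * \<delta> = M - \<zeta>\<close>, and the form becomes \<open>R * (x - y)\<^sup>2\<close>. There remain the parameters \<open>B = - \<beta>\<close> and
\<open>\<zeta>\<close>, which have to satisfy \<open>R \<le> 0\<close> and the discriminant condition for the first form.
If \<open>k \<le> M\<close>, both can be zero. Otherwise put \<open>\<zeta> = - g * B\<close>, where \<open>R = 0\<close> determines \<open>B\<close>, and the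
discriminant condition becomes the quadratic inequality in \<open>g\<close>.\<close>

lemma lyapunov_function_coefficients:
  fixes \<sigma> r b k M m :: real
  assumes pos: "\<sigma> > 0" "b > 0" "k > 0"
    and M: "(r - 1) * M = 4 * \<sigma> / b - k * (1 + m)\<^sup>2"
    and kM: "k \<le> b * M"
    and cond: "k \<le> M \<or> (\<exists>g>0. (2 * \<sigma> - b + g)\<^sup>2 * (k - M) \<le> 4 * g * (\<sigma> + 1) * (b * M - k))"
  obtains \<alpha> \<beta> \<delta> \<epsilon> \<zeta> \<eta> \<theta> :: real where
    "\<And>x y z. (4 * \<alpha> * x^3 + 2 * \<beta> * x * z + \<zeta> * y + 2 * \<eta> * x) * (\<sigma> * (y - x))
       + (2 * \<delta> * y + \<zeta> * x) * (r * x - y - x * z)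
       + (\<beta> * x\<^sup>2 + 2 * \<epsilon> * z + \<theta>) * (- b * z + x * y)
       + (k * z\<^sup>2 - 4 * \<sigma> * z + k * (y + m * x)\<^sup>2) \<le> 0"
proof -
  obtain B \<zeta> where B: "B \<ge> 0" and R: "k - M + \<zeta> * (\<sigma> + 1) \<le> 0"
    and Q: "(\<zeta> - B * (2 * \<sigma> + b))\<^sup>2 \<le> 4 * B * (b * M - b * \<zeta> + 2 * b * \<sigma> * B - k)"
    and \<zeta>: "\<zeta> \<le> 0"
  proof (cases "k \<le> M")
    case True
    then show ?thesis using that[of 0 0] by simp
  next
    case False
    with cond obtain g where g: "g > 0"
      "(2 * \<sigma> - b + g)\<^sup>2 * (k - M) \<le> 4 * g * (\<sigma> + 1) * (b * M - k)" by blast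
    define B where "B = (k - M) / (g * (\<sigma> + 1))"
    have B0: "B \<ge> 0" using g pos False by (simp add: B_def)
    have gB: "g * B * (\<sigma> + 1) = k - M" using g pos by (simp add: B_def)
    show ?thesis
    proof (rule that[of B "- g * B"])
      show "B \<ge> 0" by fact
      show "k - M + - g * B * (\<sigma> + 1) \<le> 0" using gB by simp
      show "- g * B \<le> 0" using g B0 by simp
      have "(2 * \<sigma> - b + g)\<^sup>2 * B \<le> 4 * (b * M - k)"
      proof -
        have "(2 * \<sigma> - b + g)\<^sup>2 * B = (2 * \<sigma> - b + g)\<^sup>2 * (k - M) / (g * (\<sigma> + 1))"
          by (simp add: B_def)
        also have "\<dots> \<le> 4 * g * (\<sigma> + 1) * (b * M - k) / (g * (\<sigma> + 1))"
          using g pos by (intro divide_right_mono) auto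
        also have "\<dots> = 4 * (b * M - k)" using g pos by simp
        finally show ?thesis .
      qed
      from mult_left_mono[OF this B0]
      show "(- g * B - B * (2 * \<sigma> + b))\<^sup>2 \<le> 4 * B * (b * M - b * (- g * B) + 2 * b * \<sigma> * B - k)"
        by (simp add: algebra_simps power2_eq_square)
    qed
  qed
  define R where "R = k - M + \<zeta> * (\<sigma> + 1)"
  define F where "F = b * M - b * \<zeta> + 2 * b * \<sigma> * B - k"
  define \<delta> where "\<delta> = (M - \<zeta>) / 2"
  define \<epsilon> where "\<epsilon> = \<delta> + \<sigma> * B"
  define \<theta> where "\<theta> = - (4 * \<sigma> / b)"
  define \<eta> where "\<eta> = (- 2 * R - 2 * r * \<delta> + \<zeta> * (\<sigma> + 1) - \<theta> - 2 * k * m) / (2 * \<sigma>)"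
  have F0: "F \<ge> 0"
  proof -
    have "b * \<zeta> \<le> 0" using \<zeta> pos by (simp add: mult_nonneg_nonpos)
    moreover have "2 * b * \<sigma> * B \<ge> 0" using pos B by simp
    ultimately show ?thesis using kM unfolding F_def by linarith
  qed
  have \<eta>: "2 * \<sigma> * \<eta> = - 2 * R - 2 * r * \<delta> + \<zeta> * (\<sigma> + 1) - \<theta> - 2 * k * m"
    using pos by (simp add: \<eta>_def)
  have \<delta>: "2 * \<delta> = M - \<zeta>" by (simp add: \<delta>_def)
  have \<theta>b: "b * \<theta> = - 4 * \<sigma>" using pos by (simp add: \<theta>_def)
  have T: "(r - 1) * M + \<theta> + k * (1 + m)\<^sup>2 = 0" using M by (simp add: \<theta>_def)
  define \<alpha> where "\<alpha> = B / (4 * \<sigma>)"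
  have \<alpha>: "4 * \<sigma> * \<alpha> = B" using pos by (simp add: \<alpha>_def)
  have "(4 * \<alpha> * x^3 + 2 * (- B) * x * z + \<zeta> * y + 2 * \<eta> * x) * (\<sigma> * (y - x))
       + (2 * \<delta> * y + \<zeta> * x) * (r * x - y - x * z)
       + (- B * x\<^sup>2 + 2 * \<epsilon> * z + \<theta>) * (- b * z + x * y)
       + (k * z\<^sup>2 - 4 * \<sigma> * z + k * (y + m * x)\<^sup>2) \<le> 0" (is "?S \<le> 0") for x y z
  proof -
    define C where "C = B * (2 * \<sigma> + b) - \<zeta>"
    have "?S = (- B * (x\<^sup>2)\<^sup>2 + C * x\<^sup>2 * z - F * z\<^sup>2) + R * (x - y)\<^sup>2" (is "_ = ?S'")
    proof -
      \<comment> \<open>each summand contains one defining relation of a coefficient as a factor\<close>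
      have "?S - ?S' = (4 * \<sigma> * \<alpha> - B) * x^3 * (y - x)
        + (2 * \<sigma> * \<eta> - (- 2 * R - 2 * r * \<delta> + \<zeta> * (\<sigma> + 1) - \<theta> - 2 * k * m)) * x * (y - x)
        - (b * \<theta> + 4 * \<sigma>) * z
        - (2 * \<delta> - (M - \<zeta>)) * (y\<^sup>2 + b * z\<^sup>2 - r * x\<^sup>2)
        + ((r - 1) * M + \<theta> + k * (1 + m)\<^sup>2) * x\<^sup>2"
        unfolding F_def R_def C_def \<epsilon>_def by algebra
      also have "\<dots> = 0" unfolding \<eta> T \<alpha> \<delta> \<theta>b by simp
      finally show ?thesis by simp
    qed
    moreover have "- B * (x\<^sup>2)\<^sup>2 + C * x\<^sup>2 * z - F * z\<^sup>2 \<le> 0"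
    proof (rule negative_quadratic_form[OF B F0])
      show "C\<^sup>2 \<le> 4 * B * F"
        using Q unfolding F_def C_def by (subst power2_commute)
    qed
    moreover have "R * (x - y)\<^sup>2 \<le> 0"
      using R by (auto simp: R_def mult_nonpos_nonneg)
    ultimately show ?thesis by linarith
  qed
  then show ?thesis using that by blast
qed

lemma cauchy_schwarz_split:
  fixes a c s F H :: real
  assumes "F \<ge> 0" "H \<ge> 0" "s\<^sup>2 \<le> F * H"
  shows "(c * a + s)\<^sup>2 \<le> (c\<^sup>2 + F) * (a\<^sup>2 + H)"
proof -
  have "(2 * (c * a) * s)\<^sup>2 = 4 * c\<^sup>2 * a\<^sup>2 * s\<^sup>2"
    by (simp add: power_mult_distrib)
  also have "\<dots> \<le> 4 * c\<^sup>2 * a\<^sup>2 * (F * H)"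
    using assms by (intro mult_left_mono) auto
  also have "\<dots> = (c\<^sup>2 * H + F * a\<^sup>2)\<^sup>2 - (c\<^sup>2 * H - F * a\<^sup>2)\<^sup>2"
    by algebra
  also have "\<dots> \<le> (c\<^sup>2 * H + F * a\<^sup>2)\<^sup>2" by simp
  finally have "2 * (c * a) * s \<le> c\<^sup>2 * H + F * a\<^sup>2"
    by (rule power2_le_imp_le) (use assms in simp)
  moreover have "(c\<^sup>2 + F) * (a\<^sup>2 + H) - (c * a + s)\<^sup>2
      = (c\<^sup>2 * H + F * a\<^sup>2 - 2 * (c * a) * s) + (F * H - s\<^sup>2)"
    by algebra
  ultimately show ?thesis using assms(3) by linarith
qed

text \<open>The left-hand side is the derivative of \<open>k * (w1 + m * w2)\<^sup>2 + w2\<^sup>2 + w3\<^sup>2\<close> along the second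
compound equation. In the variables \<open>sqrt k * u\<close>, \<open>w2\<close>, \<open>w3\<close> with \<open>u = w1 + m * w2\<close>, half of it is
a quadratic form in which \<open>w2\<close> and \<open>w3\<close> are coupled only to the first variable and have equal
diagonal entries, so its largest eigenvalue is explicit: \<open>(sqrt E - (\<sigma> + 1) - 2 * b) / 2\<close> with \<open>E = D\<^sup>2 + k z\<^sup>2 - 4 \<sigma> z + k (y + m x)\<^sup>2\<close>. Replacing
\<open>sqrt E\<close> by its upper bound \<open>(E + D\<^sup>2) / (2 * D)\<close> makes the rate polynomial in the state, exact at
the origin, and suitable for compensation by a Lyapunov function.\<close>

lemma compound_quadratic_form_rate:
  fixes \<sigma> r b k m D x y z w1 w2 w3 :: real
  assumes \<sigma>: "\<sigma> > 0" and k: "k > 0" and m: "\<sigma> * m = b - 1"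
    and kN: "k * (\<sigma> * r + (b - 1) * (\<sigma> - b)) = \<sigma>\<^sup>2"
    and D: "D > 0" "D\<^sup>2 = (\<sigma> - 1)\<^sup>2 + 4 * \<sigma> * r"
  shows "2 * k * (w1 + m * w2) * ((- (1 + b) * w1 - (r - z) * w2 - y * w3)
            + m * (- \<sigma> * w1 - (\<sigma> + b) * w2 - x * w3))
       + 2 * w2 * (- \<sigma> * w1 - (\<sigma> + b) * w2 - x * w3) + 2 * w3 * (x * w2 - (\<sigma> + 1) * w3)
     \<le> (D - (\<sigma> + 1) - 2 * b + (k * z\<^sup>2 - 4 * \<sigma> * z + k * (y + m * x)\<^sup>2) / (2 * D))
        * (k * (w1 + m * w2)\<^sup>2 + w2\<^sup>2 + w3\<^sup>2)"
    (is "?L \<le> (_ + ?G / _) * ?q")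
proof -
  define u where "u = w1 + m * w2"
  \<comment> \<open>the coupling coefficient that remains after the shear \<open>w1 = u - m * w2\<close>\<close>
  define N where "N = r - m * (b - \<sigma>)"
  have w1: "w1 = u - m * w2" by (simp add: u_def)
  have \<sigma>N: "\<sigma> * N = \<sigma> * r + (b - 1) * (\<sigma> - b)"
  proof -
    have "\<sigma> * N = \<sigma> * r - (\<sigma> * m) * (b - \<sigma>)" by (simp add: N_def algebra_simps)
    then show ?thesis unfolding m by (simp add: algebra_simps)
  qed
  have kN': "k * N = \<sigma>"
  proof -
    have "\<sigma> * (k * N) = \<sigma> * \<sigma>" using kN \<sigma>N by algebra
    then show ?thesis using \<sigma> by simp
  qed
  define f g where "f = k * z - 2 * \<sigma>" and "g = k * (y + m * x)"
  define H where "H = w2\<^sup>2 + w3\<^sup>2"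
  define P where "P = k * u\<^sup>2"
  have nn: "H \<ge> 0" "P \<ge> 0" using k by (auto simp: H_def P_def)
  define S where "S = u * (w2 * f - w3 * g)"
  define c where "c = \<sigma> + 1 - 2 * b"
  define F where "F = ?G + 4 * \<sigma> * N"
  have L: "?L = c * (P - H) + 2 * S - (\<sigma> + 1 + 2 * b) * (P + H)"
  proof -
    have "?L - (c * (P - H) + 2 * S - (\<sigma> + 1 + 2 * b) * (P + H)) =
       2 * u * w2 * (\<sigma> - k * N)
       + (\<sigma> * m - (b - 1)) * (2 * w2\<^sup>2 - 2 * k * u\<^sup>2 + 2 * k * m * u * w2)"
      unfolding w1 H_def P_def S_def c_def f_def g_def N_def by algebra
    then show ?thesis using kN' m by simp
  qed
  have kF: "k * F = f\<^sup>2 + g\<^sup>2"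
  proof -
    have "k * F - (f\<^sup>2 + g\<^sup>2) = 4 * \<sigma> * (k * N - \<sigma>)"
      unfolding F_def f_def g_def by algebra
    then show ?thesis using kN' by simp
  qed
  then have F0: "F \<ge> 0" using k by (metis sum_power2_ge_zero zero_le_mult_iff not_le)
  define E where "E = c\<^sup>2 + F"
  have E0: "E \<ge> 0" using F0 by (simp add: E_def)
  have E: "E = D\<^sup>2 + ?G"
  proof -
    have "E - (D\<^sup>2 + ?G) = c\<^sup>2 + 4 * (\<sigma> * N) - ((\<sigma> - 1)\<^sup>2 + 4 * \<sigma> * r)"
      by (simp add: E_def F_def D(2))
    also have "\<dots> = 0" unfolding \<sigma>N c_def by algebra
    finally show ?thesis by simp
  qed
  have "S\<^sup>2 \<le> F * (P * H)"
  proof -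
    have "(w2 * f - w3 * g)\<^sup>2 \<le> H * (f\<^sup>2 + g\<^sup>2)"
    proof -
      have "H * (f\<^sup>2 + g\<^sup>2) - (w2 * f - w3 * g)\<^sup>2 = (w2 * g + w3 * f)\<^sup>2"
        by (simp add: H_def algebra_simps power2_eq_square)
      then show ?thesis by (metis diff_ge_0_iff_ge zero_le_power2)
    qed
    then have "u\<^sup>2 * (w2 * f - w3 * g)\<^sup>2 \<le> u\<^sup>2 * (H * (k * F))"
      unfolding kF by (rule mult_left_mono) simp
    moreover have "S\<^sup>2 = u\<^sup>2 * (w2 * f - w3 * g)\<^sup>2" by (simp add: S_def power_mult_distrib)
    moreover have "u\<^sup>2 * (H * (k * F)) = F * (P * H)" by (simp add: P_def mult_ac)
    ultimately show ?thesis by (simp only:)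
  qed
  moreover have "(2 * S)\<^sup>2 = 4 * S\<^sup>2" "F * (4 * P * H) = 4 * (F * (P * H))" by algebra+
  ultimately have S2: "(2 * S)\<^sup>2 \<le> F * (4 * P * H)" by linarith
  have square: "(P - H)\<^sup>2 + 4 * P * H = (P + H)\<^sup>2" by algebra
  have "(c * (P - H) + 2 * S)\<^sup>2 \<le> E * ((P - H)\<^sup>2 + 4 * P * H)"
    unfolding E_def by (rule cauchy_schwarz_split[OF F0 _ S2]) (use nn in simp)
  then have "(c * (P - H) + 2 * S)\<^sup>2 \<le> E * (P + H)\<^sup>2"
    unfolding square .
  moreover have "E * (P + H)\<^sup>2 \<le> ((E + D\<^sup>2) / (2 * D) * (P + H))\<^sup>2"
  proof -
    have "(E + D\<^sup>2)\<^sup>2 - E * (4 * D\<^sup>2) = (E - D\<^sup>2)\<^sup>2" by algebra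
    then have "E * (4 * D\<^sup>2) \<le> (E + D\<^sup>2)\<^sup>2"
      using zero_le_power2[of "E - D\<^sup>2"] by linarith
    moreover have "((E + D\<^sup>2) / (2 * D))\<^sup>2 = (E + D\<^sup>2)\<^sup>2 / (4 * D\<^sup>2)"
      by (simp add: power_divide power_mult_distrib)
    ultimately have "E \<le> ((E + D\<^sup>2) / (2 * D))\<^sup>2"
      using pos_le_divide_eq[of "4 * D\<^sup>2" E "(E + D\<^sup>2)\<^sup>2"] D(1) by simp
    from mult_right_mono[OF this, of "(P + H)\<^sup>2"] show ?thesis
      by (subst power_mult_distrib) simp
  qed
  ultimately have sq: "(c * (P - H) + 2 * S)\<^sup>2 \<le> ((E + D\<^sup>2) / (2 * D) * (P + H))\<^sup>2"
    by (rule order_trans)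
  have "0 \<le> (E + D\<^sup>2) / (2 * D) * (P + H)"
    using E0 D(1) nn by (intro mult_nonneg_nonneg divide_nonneg_nonneg add_nonneg_nonneg) simp_all
  with sq have bound: "c * (P - H) + 2 * S \<le> (E + D\<^sup>2) / (2 * D) * (P + H)"
    by (rule power2_le_imp_le)
  have split: "(D\<^sup>2 + h + D\<^sup>2) / (2 * D) * p - (\<sigma> + 1 + 2 * b) * p
      = (D - (\<sigma> + 1) - 2 * b + h / (2 * D)) * p" for h p
    using D(1) by (simp add: field_simps power2_eq_square)
  have "?L \<le> (E + D\<^sup>2) / (2 * D) * (P + H) - (\<sigma> + 1 + 2 * b) * (P + H)"
    unfolding L using bound by (rule diff_right_mono)
  then have "?L \<le> (D - (\<sigma> + 1) - 2 * b + ?G / (2 * D)) * (P + H)"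
    unfolding E split .
  then show ?thesis
    unfolding P_def H_def u_def add.assoc .
qed

text \<open>For \<open>k = \<sigma>\<^sup>2 / N\<close> the parameter conditions turn out to be exactly what the coefficients need: up
to positive factors, \<open>A \<le> 3 * \<sigma>\<^sup>2 * (r - 1)\<close> is \<open>k \<le> b * M\<close>, the first alternative is \<open>k \<le> M\<close>, and
a positive root of the quadratic equation gives equality in the discriminant condition.\<close>

lemma lorenz_lyapunov_function:
  fixes \<sigma> r b :: real
  defines "A \<equiv> b * (b + \<sigma> - 1)\<^sup>2 - 4 * \<sigma> * (\<sigma> * b + b - b\<^sup>2)"
    and "N \<equiv> \<sigma> * r + (b - 1) * (\<sigma> - b)"
  assumes pos: "\<sigma> > 0" "b > 0" "r > 1" "N > 0"
    and hyp: "A \<le> 3 * \<sigma>\<^sup>2 * (r - 1)"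
    and cond: "A + \<sigma>\<^sup>2 * (r - 1) * (b - 4) \<le> 0 \<or>
      (\<exists>g>0. (2 * \<sigma> - b + g)\<^sup>2 * (A + \<sigma>\<^sup>2 * (r - 1) * (b - 4))
         + 4 * b * g * (\<sigma> + 1) * (A - 3 * \<sigma>\<^sup>2 * (r - 1)) = 0)"
  obtains \<alpha> \<beta> \<delta> \<epsilon> \<zeta> \<eta> \<theta> :: real where
    "\<And>x y z. (4 * \<alpha> * x^3 + 2 * \<beta> * x * z + \<zeta> * y + 2 * \<eta> * x) * (\<sigma> * (y - x))
       + (2 * \<delta> * y + \<zeta> * x) * (r * x - y - x * z)
       + (\<beta> * x\<^sup>2 + 2 * \<epsilon> * z + \<theta>) * (- b * z + x * y)
       + (\<sigma>\<^sup>2 / N * z\<^sup>2 - 4 * \<sigma> * z + \<sigma>\<^sup>2 / N * (y + (b - 1) / \<sigma> * x)\<^sup>2) \<le> 0"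
proof -
  define k where "k = \<sigma>\<^sup>2 / N"
  define M where "M = (4 * \<sigma>\<^sup>2 * (r - 1) - A) / (b * N * (r - 1))"
  define q where "q = b * N * (r - 1)"
  have k: "k > 0" "N * k = \<sigma>\<^sup>2" using pos by (auto simp: k_def)
  have q: "q > 0" using pos by (simp add: q_def)
  have M: "q * M = 4 * \<sigma>\<^sup>2 * (r - 1) - A" using q by (simp add: M_def flip: q_def)
  have qk: "q * k = b * (r - 1) * \<sigma>\<^sup>2"
    using k(2) by (simp add: q_def mult_ac)
  have gap: "q * (k - M) = A + \<sigma>\<^sup>2 * (r - 1) * (b - 4)"
    unfolding right_diff_distrib M qk by (simp add: algebra_simps)
  have gap': "q * (b * M - k) = b * (3 * \<sigma>\<^sup>2 * (r - 1) - A)"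
  proof -
    have "q * (b * M - k) = b * (q * M) - q * k" by (simp add: algebra_simps)
    then show ?thesis unfolding M qk by (simp add: algebra_simps)
  qed
  have T: "(r - 1) * M = 4 * \<sigma> / b - k * (1 + (b - 1) / \<sigma>)\<^sup>2"
  proof -
    have "b * N * ((r - 1) * M) = 4 * \<sigma>\<^sup>2 * (r - 1) - A"
      using M by (simp add: q_def mult_ac)
    also have "\<dots> = 4 * \<sigma> * N - b * (b + \<sigma> - 1)\<^sup>2"
      unfolding A_def N_def by algebra
    also have "\<dots> = b * N * (4 * \<sigma> / b - k * (1 + (b - 1) / \<sigma>)\<^sup>2)"
    proof -
      have "b * N * (k * (1 + (b - 1) / \<sigma>)\<^sup>2) = b * (\<sigma> * (1 + (b - 1) / \<sigma>))\<^sup>2"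
        using k(2) by (simp add: power_mult_distrib mult_ac)
      also have "\<sigma> * (1 + (b - 1) / \<sigma>) = b + \<sigma> - 1"
        using pos by (simp add: field_simps)
      finally show ?thesis using pos by (simp add: right_diff_distrib)
    qed
    finally show ?thesis using pos by simp
  qed
  have kM: "k \<le> b * M"
  proof -
    have "q * (b * M - k) \<ge> 0" unfolding gap' using hyp pos by simp
    then show ?thesis using q by (simp add: zero_le_mult_iff)
  qed
  have "k \<le> M \<or> (\<exists>g>0. (2 * \<sigma> - b + g)\<^sup>2 * (k - M) \<le> 4 * g * (\<sigma> + 1) * (b * M - k))"
    using cond
  proof
    assume "A + \<sigma>\<^sup>2 * (r - 1) * (b - 4) \<le> 0"
    then have "q * (k - M) \<le> 0" unfolding gap .
    then show ?thesis using q by (simp add: mult_le_0_iff)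
  next
    assume "\<exists>g>0. (2 * \<sigma> - b + g)\<^sup>2 * (A + \<sigma>\<^sup>2 * (r - 1) * (b - 4))
         + 4 * b * g * (\<sigma> + 1) * (A - 3 * \<sigma>\<^sup>2 * (r - 1)) = 0"
    then obtain g where g: "g > 0" "(2 * \<sigma> - b + g)\<^sup>2 * (A + \<sigma>\<^sup>2 * (r - 1) * (b - 4))
         + 4 * b * g * (\<sigma> + 1) * (A - 3 * \<sigma>\<^sup>2 * (r - 1)) = 0" by blast
    have "q * ((2 * \<sigma> - b + g)\<^sup>2 * (k - M)) = (2 * \<sigma> - b + g)\<^sup>2 * (q * (k - M))" by simp
    also have "\<dots> = 4 * g * (\<sigma> + 1) * (b * (3 * \<sigma>\<^sup>2 * (r - 1) - A))"
      unfolding gap using g(2) by algebra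
    also have "\<dots> = q * (4 * g * (\<sigma> + 1) * (b * M - k))"
      unfolding gap'[symmetric] by simp
    finally have "(2 * \<sigma> - b + g)\<^sup>2 * (k - M) = 4 * g * (\<sigma> + 1) * (b * M - k)"
      using q by simp
    with g(1) show ?thesis by auto
  qed
  show ?thesis
  proof (rule lyapunov_function_coefficients[OF pos(1,2) k(1) T kM \<open>k \<le> M \<or> _\<close>])
    fix \<alpha> \<beta> \<delta> \<epsilon> \<zeta> \<eta> \<theta>
    assume "\<And>x y z. (4 * \<alpha> * x^3 + 2 * \<beta> * x * z + \<zeta> * y + 2 * \<eta> * x) * (\<sigma> * (y - x))
       + (2 * \<delta> * y + \<zeta> * x) * (r * x - y - x * z)
       + (\<beta> * x\<^sup>2 + 2 * \<epsilon> * z + \<theta>) * (- b * z + x * y)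
       + (k * z\<^sup>2 - 4 * \<sigma> * z + k * (y + (b - 1) / \<sigma> * x)\<^sup>2) \<le> 0"
    then show ?thesis unfolding k_def by (rule that)
  qed
qed

section \<open>The second compound equation of the Lorenz flow\<close>

lemma jacobian_lorenz:
  "jacobian (lorenz \<sigma> r b) (at v) =
     vector [vector [- \<sigma>, \<sigma>, 0], vector [r - v $ 3, - 1, - v $ 1], vector [v $ 2, v $ 1, - b]]"
    (is "_ = ?J")
proof -
  have eq: "lorenz \<sigma> r b = (\<lambda>v. (\<sigma> * (v $ 2 - v $ 1)) *\<^sub>R axis 1 1
      + (r * v $ 1 - v $ 2 - v $ 1 * v $ 3) *\<^sub>R axis 2 1
      + (- b * v $ 3 + v $ 1 * v $ 2) *\<^sub>R axis 3 1)"
    by (simp add: lorenz_def Let_def fun_eq_iff vec_eq_iff forall_3 axis_def)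
  have nth: "((\<lambda>v. v $ i) has_derivative (\<lambda>h. h $ i)) (at v)" for i :: 3 and v :: "real^3"
    by (rule bounded_linear_imp_has_derivative) (rule bounded_linear_vec_nth)
  have "(lorenz \<sigma> r b has_derivative (\<lambda>h. ?J *v h)) (at v)"
    unfolding eq
    by (rule derivative_eq_intros nth refl)+
      (simp add: fun_eq_iff vec_eq_iff forall_3 axis_def matrix_vector_mult_def sum_3 algebra_simps)
  then have "frechet_derivative (lorenz \<sigma> r b) (at v) = (\<lambda>h. ?J *v h)"
    by (rule frechet_derivative_at[symmetric])
  then show ?thesis by (simp add: jacobian_def)
qed

text \<open>The second compound of a linear equation: the oriented area spanned by two solutions of
\<open>u' = J u\<close> evolves under \<open>trace J\<close> times the identity minus the transpose of \<open>J\<close>.\<close>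

lemma cross_product_compound:
  fixes J :: "real^3^3"
  shows "(J *v u) \<times> v + u \<times> (J *v v) = trace J *\<^sub>R (u \<times> v) - transpose J *v (u \<times> v)"
  by (simp add: cross3_def vec_eq_iff forall_3 matrix_vector_mult_def sum_3 trace_def transpose_def
      algebra_simps)

lemma bounded_bilinear_cross: "bounded_bilinear cross3"
  using bilinear_cross bilinear_conv_bounded_bilinear by blast

locale lorenz_flow =
  fixes \<sigma> r b :: real and \<phi> :: "real \<Rightarrow> real^3 \<Rightarrow> real^3" and X :: "real \<Rightarrow> real^3 \<Rightarrow> real^3^3"
  assumes pos: "\<sigma> > 0" "r > 0" "b > 0"
    and flow: "solution_semiflow (lorenz \<sigma> r b) \<phi>"
    and fundamental: "fundamental_matrix (lorenz \<sigma> r b) \<phi> X"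
begin

abbreviation J :: "real^3 \<Rightarrow> real^3^3" where
  "J v \<equiv> vector [vector [- \<sigma>, \<sigma>, 0], vector [r - v $ 3, - 1, - v $ 1], vector [v $ 2, v $ 1, - b]]"

lemma flow_component_derivs:
  assumes "t \<ge> 0"
  shows "((\<lambda>s. \<phi> s v $ 1) has_real_derivative \<sigma> * (\<phi> t v $ 2 - \<phi> t v $ 1)) (at t within {0..})"
    "((\<lambda>s. \<phi> s v $ 2) has_real_derivative
        r * \<phi> t v $ 1 - \<phi> t v $ 2 - \<phi> t v $ 1 * \<phi> t v $ 3) (at t within {0..})"
    "((\<lambda>s. \<phi> s v $ 3) has_real_derivative
        - b * \<phi> t v $ 3 + \<phi> t v $ 1 * \<phi> t v $ 2) (at t within {0..})"
proof -
  have "((\<lambda>s. \<phi> s v) has_vector_derivative lorenz \<sigma> r b (\<phi> t v)) (at t within {0..})"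
    using flow assms by (auto simp: solution_semiflow_def)
  from bounded_linear.has_vector_derivative[OF bounded_linear_vec_nth this]
  have "((\<lambda>s. \<phi> s v $ i) has_real_derivative lorenz \<sigma> r b (\<phi> t v) $ i) (at t within {0..})" for i
    by (simp add: has_real_derivative_iff_has_vector_derivative)
  from this[of 1] this[of 2] this[of 3]
  show "((\<lambda>s. \<phi> s v $ 1) has_real_derivative \<sigma> * (\<phi> t v $ 2 - \<phi> t v $ 1)) (at t within {0..})"
    "((\<lambda>s. \<phi> s v $ 2) has_real_derivative
        r * \<phi> t v $ 1 - \<phi> t v $ 2 - \<phi> t v $ 1 * \<phi> t v $ 3) (at t within {0..})"
    "((\<lambda>s. \<phi> s v $ 3) has_real_derivative
        - b * \<phi> t v $ 3 + \<phi> t v $ 1 * \<phi> t v $ 2) (at t within {0..})"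
    by (simp_all add: lorenz_def Let_def)
qed

lemma column_deriv:
  assumes "t \<ge> 0"
  shows "((\<lambda>s. column i (X s v)) has_vector_derivative J (\<phi> t v) *v column i (X t v))
     (at t within {0..})"
proof -
  have "((\<lambda>s. X s v) has_vector_derivative J (\<phi> t v) ** X t v) (at t within {0..})"
    using fundamental assms by (auto simp: fundamental_matrix_def jacobian_lorenz)
  moreover have "bounded_linear (\<lambda>A. column i A :: real^3)" for i :: 3
    by (rule linear_conv_bounded_linear[THEN iffD1], rule linearI) (simp_all add: column_def vec_eq_iff)
  ultimately have "((\<lambda>s. column i (X s v)) has_vector_derivative column i (J (\<phi> t v) ** X t v))
     (at t within {0..})"
    by (rule bounded_linear.has_vector_derivative[rotated])
  moreover have "column i (J (\<phi> t v) ** X t v) = J (\<phi> t v) *v column i (X t v)"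
    by (simp add: matrix_vector_mul_assoc flip: matrix_vector_mult_basis)
  ultimately show ?thesis by simp
qed

definition area :: "3 \<Rightarrow> 3 \<Rightarrow> real \<Rightarrow> real^3 \<Rightarrow> real^3" where
  "area i j t v = column i (X t v) \<times> column j (X t v)"

lemma area_deriv:
  assumes "t \<ge> 0"
  shows "((\<lambda>s. area i j s v) has_vector_derivative
     trace (J (\<phi> t v)) *\<^sub>R area i j t v - transpose (J (\<phi> t v)) *v area i j t v) (at t within {0..})"
  unfolding area_def cross_product_compound[symmetric]
  using bounded_bilinear.has_vector_derivative[OF bounded_bilinear_cross
      column_deriv[OF assms, of i] column_deriv[OF assms, of j]]
  by (simp add: add.commute)

lemma area_component_derivs:
  assumes "t \<ge> 0"
  shows "((\<lambda>s. area i j s v $ 1) has_real_derivative - (1 + b) * area i j t v $ 1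
        - (r - \<phi> t v $ 3) * area i j t v $ 2 - \<phi> t v $ 2 * area i j t v $ 3) (at t within {0..})"
    "((\<lambda>s. area i j s v $ 2) has_real_derivative - \<sigma> * area i j t v $ 1
        - (\<sigma> + b) * area i j t v $ 2 - \<phi> t v $ 1 * area i j t v $ 3) (at t within {0..})"
    "((\<lambda>s. area i j s v $ 3) has_real_derivative
        \<phi> t v $ 1 * area i j t v $ 2 - (\<sigma> + 1) * area i j t v $ 3) (at t within {0..})"
proof -
  from bounded_linear.has_vector_derivative[OF bounded_linear_vec_nth area_deriv[OF assms]]
  have d: "((\<lambda>s. area i j s v $ n) has_real_derivative (trace (J (\<phi> t v)) *\<^sub>R area i j t v
      - transpose (J (\<phi> t v)) *v area i j t v) $ n) (at t within {0..})" for n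
    by (simp add: has_real_derivative_iff_has_vector_derivative)
  show "((\<lambda>s. area i j s v $ 1) has_real_derivative - (1 + b) * area i j t v $ 1
        - (r - \<phi> t v $ 3) * area i j t v $ 2 - \<phi> t v $ 2 * area i j t v $ 3) (at t within {0..})"
    by (rule DERIV_cong[OF d])
      (simp add: trace_def transpose_def matrix_vector_mult_def sum_3 algebra_simps)
  show "((\<lambda>s. area i j s v $ 2) has_real_derivative - \<sigma> * area i j t v $ 1
        - (\<sigma> + b) * area i j t v $ 2 - \<phi> t v $ 1 * area i j t v $ 3) (at t within {0..})"
    by (rule DERIV_cong[OF d])
      (simp add: trace_def transpose_def matrix_vector_mult_def sum_3 algebra_simps)
  show "((\<lambda>s. area i j s v $ 3) has_real_derivative
        \<phi> t v $ 1 * area i j t v $ 2 - (\<sigma> + 1) * area i j t v $ 3) (at t within {0..})"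
    by (rule DERIV_cong[OF d])
      (simp add: trace_def transpose_def matrix_vector_mult_def sum_3 algebra_simps)
qed

lemma det_eq_inner_area: "det (X t v) = column 1 (X t v) \<bullet> area 2 3 t v"
  by (simp add: area_def cross3_simps column_def)

text \<open>Liouville's formula. The divergence of the Lorenz field is constant, so all volumes contract at
the same rate \<open>\<sigma> + 1 + b\<close>, whatever the orbit.\<close>

lemma det_deriv:
  assumes "t \<ge> 0"
  shows "((\<lambda>s. det (X s v)) has_real_derivative - (\<sigma> + 1 + b) * det (X t v)) (at t within {0..})"
proof -
  let ?c = "column 1 (X t v)" and ?a = "area 2 3 t v" and ?J = "J (\<phi> t v)"
  have "((\<lambda>s. column 1 (X s v) \<bullet> area 2 3 s v) has_vector_derivative
      ?c \<bullet> (trace ?J *\<^sub>R ?a - transpose ?J *v ?a) + (?J *v ?c) \<bullet> ?a) (at t within {0..})"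
    by (rule bounded_bilinear.has_vector_derivative[OF bounded_bilinear_inner
          column_deriv[OF assms] area_deriv[OF assms]])
  moreover have "?c \<bullet> (trace ?J *\<^sub>R ?a - transpose ?J *v ?a) + (?J *v ?c) \<bullet> ?a = trace ?J * (?c \<bullet> ?a)"
  proof -
    have "x \<bullet> (transpose A *v y) = (A *v x) \<bullet> y" for A :: "real^3^3" and x y
      by (metis dot_lmul_matrix inner_commute transpose_matrix_vector)
    then show ?thesis by (simp add: inner_diff_right)
  qed
  moreover have "trace ?J = - (\<sigma> + 1 + b)" by (simp add: trace_def sum_3)
  ultimately show ?thesis
    unfolding det_eq_inner_area has_real_derivative_iff_has_vector_derivative by simp
qed

lemma det_fundamental:
  assumes "t \<ge> 0"
  shows "det (X t v) = exp (- (\<sigma> + 1 + b) * t)"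
proof -
  have "det (X t v) = det (X 0 v) * exp (- (\<sigma> + 1 + b) * t)"
    by (rule linear_ode_on_half_line[OF det_deriv assms])
  moreover have "X 0 v = mat 1" using fundamental by (simp add: fundamental_matrix_def)
  ultimately show ?thesis by simp
qed

text \<open>The product of the two largest singular values is comparable with the largest of the three areas.
The lower estimate is stated for one pair of columns only, since growth of a single area suffices.\<close>

lemma singular_values_fundamental:
  assumes "t \<ge> 0"
  obtains s1 s2 s3 where "singular_values (X t v) = [s1, s2, s3]" "s1 \<ge> s2" "s2 \<ge> s3" "s3 \<ge> 0"
    "s1 * s2 * s3 = exp (- (\<sigma> + 1 + b) * t)"
    "(s1 * s2)\<^sup>2 \<le> (norm (area 1 2 t v))\<^sup>2 + (norm (area 2 3 t v))\<^sup>2 + (norm (area 3 1 t v))\<^sup>2"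
    "(norm (area 2 3 t v))\<^sup>2 \<le> 3 * (s1 * s2)\<^sup>2"
proof -
  obtain s1 s2 s3 where s: "singular_values (X t v) = [s1, s2, s3]" "s1 \<ge> s2" "s2 \<ge> s3" "s3 \<ge> 0"
    "s1 * s2 * s3 = \<bar>det (X t v)\<bar>"
    "(s1 * s2)\<^sup>2 + (s2 * s3)\<^sup>2 + (s3 * s1)\<^sup>2 =
       (norm (area 1 2 t v))\<^sup>2 + (norm (area 2 3 t v))\<^sup>2 + (norm (area 3 1 t v))\<^sup>2"
    unfolding area_def by (rule singular_values_3)
  have "(s2 * s3)\<^sup>2 \<le> (s1 * s2)\<^sup>2" "(s3 * s1)\<^sup>2 \<le> (s1 * s2)\<^sup>2"
    using s(2-4) by (auto intro!: power_mono mult_mono simp: mult.commute)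
  then have "(norm (area 2 3 t v))\<^sup>2 \<le> 3 * (s1 * s2)\<^sup>2"
    using s(6) zero_le_power2[of "norm (area 1 2 t v)"] zero_le_power2[of "norm (area 3 1 t v)"]
    by linarith
  moreover have "(s1 * s2)\<^sup>2 \<le> (norm (area 1 2 t v))\<^sup>2 + (norm (area 2 3 t v))\<^sup>2 + (norm (area 3 1 t v))\<^sup>2"
    using s(6) zero_le_power2[of "s2 * s3"] zero_le_power2[of "s3 * s1"] by linarith
  ultimately show ?thesis
    using that s(1-5) det_fundamental[OF assms, of v] by simp
qed

section \<open>Upper bound on bounded orbits and lower bound at the origin\<close>


text \<open>The quadratic form \<open>q\<close> of the area vector grows at most at the rate \<open>D - (\<sigma> + 1) - 2 * b\<close> plus a state-dependent
excess \<open>G / (2 * D)\<close>, and \<open>V / (2 * D)\<close> decreases at least as fast as that excess accumulates. So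
\<open>q * exp (V / (2 * D))\<close> grows at the constant rate alone, and \<open>V\<close> is bounded on the compact set.\<close>

lemma area_growth_on_bounded_orbit:
  fixes K :: "(real^3) set" and \<alpha> \<beta> \<delta> \<epsilon> \<zeta> \<eta> \<theta> k m D :: real
  assumes K: "compact K" "\<And>t. t \<ge> 0 \<Longrightarrow> \<phi> t v \<in> K"
    and k: "k > 0" "k * (\<sigma> * r + (b - 1) * (\<sigma> - b)) = \<sigma>\<^sup>2" and m: "\<sigma> * m = b - 1"
    and D: "D > 0" "D\<^sup>2 = (\<sigma> - 1)\<^sup>2 + 4 * \<sigma> * r"
    and lyap: "\<And>x y z. (4 * \<alpha> * x^3 + 2 * \<beta> * x * z + \<zeta> * y + 2 * \<eta> * x) * (\<sigma> * (y - x))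
       + (2 * \<delta> * y + \<zeta> * x) * (r * x - y - x * z)
       + (\<beta> * x\<^sup>2 + 2 * \<epsilon> * z + \<theta>) * (- b * z + x * y)
       + (k * z\<^sup>2 - 4 * \<sigma> * z + k * (y + m * x)\<^sup>2) \<le> 0"
  shows "\<exists>C. \<forall>t\<ge>0. (norm (area i j t v))\<^sup>2 \<le> C * exp ((D - (\<sigma> + 1) - 2 * b) * t)"
proof -
  define V :: "real^3 \<Rightarrow> real" where "V u = \<alpha> * u$1 ^ 4 + \<beta> * (u$1)\<^sup>2 * u$3 + \<delta> * (u$2)\<^sup>2
      + \<epsilon> * (u$3)\<^sup>2 + \<zeta> * u$1 * u$2 + \<eta> * (u$1)\<^sup>2 + \<theta> * u$3" for u
  define V' where "V' t = (4 * \<alpha> * \<phi> t v$1 ^ 3 + 2 * \<beta> * \<phi> t v$1 * \<phi> t v$3 + \<zeta> * \<phi> t v$2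
         + 2 * \<eta> * \<phi> t v$1) * (\<sigma> * (\<phi> t v$2 - \<phi> t v$1))
       + (2 * \<delta> * \<phi> t v$2 + \<zeta> * \<phi> t v$1) * (r * \<phi> t v$1 - \<phi> t v$2 - \<phi> t v$1 * \<phi> t v$3)
       + (\<beta> * (\<phi> t v$1)\<^sup>2 + 2 * \<epsilon> * \<phi> t v$3 + \<theta>) * (- b * \<phi> t v$3 + \<phi> t v$1 * \<phi> t v$2)" for t
  have dV: "((\<lambda>s. V (\<phi> s v)) has_real_derivative V' t) (at t within {0..})" if "t \<ge> 0" for t
  proof -
    note d = flow_component_derivs[OF that, of v]
    show ?thesis
      unfolding V_def
      by (rule derivative_eq_intros d refl)+
        (simp add: V'_def power2_eq_square power3_eq_cube algebra_simps)
  qed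
  define w where "w n t = area i j t v $ n" for n t
  define q where "q t = k * (w 1 t + m * w 2 t)\<^sup>2 + (w 2 t)\<^sup>2 + (w 3 t)\<^sup>2" for t
  define w1' w2' w3' where "w1' t = - (1 + b) * w 1 t - (r - \<phi> t v$3) * w 2 t - \<phi> t v$2 * w 3 t"
    and "w2' t = - \<sigma> * w 1 t - (\<sigma> + b) * w 2 t - \<phi> t v$1 * w 3 t"
    and "w3' t = \<phi> t v$1 * w 2 t - (\<sigma> + 1) * w 3 t" for t
  define q' where "q' t = 2 * k * (w 1 t + m * w 2 t) * (w1' t + m * w2' t)
      + 2 * w 2 t * w2' t + 2 * w 3 t * w3' t" for t
  have dq: "(q has_real_derivative q' t) (at t within {0..})" if "t \<ge> 0" for t
  proof -
    note d = area_component_derivs[OF that, of i j v, folded w_def, folded w1'_def w2'_def w3'_def]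
    show ?thesis
      unfolding q_def q'_def
      by (rule derivative_eq_intros d refl)+ (simp add: algebra_simps)
  qed
  define G where "G t = k * (\<phi> t v$3)\<^sup>2 - 4 * \<sigma> * \<phi> t v$3 + k * (\<phi> t v$2 + m * \<phi> t v$1)\<^sup>2" for t
  have rate: "q' t \<le> (D - (\<sigma> + 1) - 2 * b + G t / (2 * D)) * q t" for t
    using compound_quadratic_form_rate[OF pos(1) k(1) m k(2) D]
    unfolding q_def q'_def w1'_def w2'_def w3'_def G_def by blast
  have q0: "q t \<ge> 0" for t
    using k(1) by (simp add: q_def)
  define f where "f t = q t * exp (V (\<phi> t v) / (2 * D))" for t
  have grow: "f t \<le> f 0 * exp ((D - (\<sigma> + 1) - 2 * b) * t)" if t: "t \<ge> 0" for t
  proof (rule gronwall_on_half_line[OF _ _ t])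
    fix s :: real assume s: "s \<ge> 0"
    show "(f has_real_derivative (q' s + q s * (V' s / (2 * D))) * exp (V (\<phi> s v) / (2 * D)))
        (at s within {0..})"
    proof -
      have "((\<lambda>s. exp (V (\<phi> s v) / (2 * D))) has_real_derivative
          exp (V (\<phi> s v) / (2 * D)) * (V' s / (2 * D))) (at s within {0..})"
        by (rule DERIV_chain2[OF DERIV_exp DERIV_cdivide[OF dV[OF s]]])
      from DERIV_mult[OF dq[OF s] this] show ?thesis
        unfolding f_def by (rule DERIV_cong) (simp add: algebra_simps)
    qed
    have "V' s + G s \<le> 0" unfolding V'_def G_def by (rule lyap)
    then have "q s * ((V' s + G s) / (2 * D)) \<le> 0"
      using D(1) q0[of s] by (intro mult_nonneg_nonpos divide_nonpos_pos) auto
    moreover have "(D - (\<sigma> + 1) - 2 * b + G s / (2 * D)) * q s + q s * (V' s / (2 * D))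
        = (D - (\<sigma> + 1) - 2 * b) * q s + q s * ((V' s + G s) / (2 * D))"
      by (simp add: add_divide_distrib algebra_simps)
    ultimately have "q' s + q s * (V' s / (2 * D)) \<le> (D - (\<sigma> + 1) - 2 * b) * q s"
      using rate[of s] by linarith
    from mult_right_mono[OF this exp_ge_zero]
    show "(q' s + q s * (V' s / (2 * D))) * exp (V (\<phi> s v) / (2 * D)) \<le> (D - (\<sigma> + 1) - 2 * b) * f s"
      by (simp add: f_def mult.assoc)
  qed
  have "continuous_on K V"
    unfolding V_def by (intro continuous_intros)
  from compact_continuous_image[OF this K(1)] have "bounded (V ` K)" by (rule compact_imp_bounded)
  then obtain B where B: "\<And>u. u \<in> K \<Longrightarrow> \<bar>V u\<bar> \<le> B"
    unfolding bounded_iff by auto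
  define c where "c = 1 + 2 / k + 2 * m\<^sup>2"
  show ?thesis
  proof (intro exI[where x = "c * f 0 * exp (B / (2 * D))"] allI impI)
    fix t :: real assume t: "t \<ge> 0"
    have norm: "(norm (area i j t v))\<^sup>2 = (w 1 t)\<^sup>2 + (w 2 t)\<^sup>2 + (w 3 t)\<^sup>2"
      by (simp only: power2_norm_eq_inner) (simp add: inner_vec_def sum_3 w_def power2_eq_square)
    have "(w 1 t)\<^sup>2 \<le> 2 * (w 1 t + m * w 2 t)\<^sup>2 + 2 * m\<^sup>2 * (w 2 t)\<^sup>2"
    proof -
      have "2 * (w 1 t + m * w 2 t)\<^sup>2 + 2 * m\<^sup>2 * (w 2 t)\<^sup>2 - (w 1 t)\<^sup>2 = (w 1 t + 2 * m * w 2 t)\<^sup>2"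
        by algebra
      then show ?thesis using zero_le_power2[of "w 1 t + 2 * m * w 2 t"] by linarith
    qed
    moreover have "2 * (w 1 t + m * w 2 t)\<^sup>2 \<le> 2 / k * q t"
    proof -
      have "2 / k * (k * (w 1 t + m * w 2 t)\<^sup>2) \<le> 2 / k * q t"
        using k(1) by (intro mult_left_mono) (simp_all add: q_def)
      then show ?thesis using k(1) by simp
    qed
    moreover have "2 * m\<^sup>2 * (w 2 t)\<^sup>2 \<le> 2 * m\<^sup>2 * q t"
      using k(1) by (intro mult_left_mono) (simp_all add: q_def)
    moreover have "(w 2 t)\<^sup>2 + (w 3 t)\<^sup>2 \<le> q t" using k(1) by (simp add: q_def)
    ultimately have wq: "(norm (area i j t v))\<^sup>2 \<le> c * q t"
      unfolding norm c_def distrib_right by linarith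
    have "q t = f t * exp (- V (\<phi> t v) / (2 * D))"
      by (simp add: f_def mult.assoc flip: exp_add)
    also have "\<dots> \<le> f 0 * exp ((D - (\<sigma> + 1) - 2 * b) * t) * exp (B / (2 * D))"
    proof (intro mult_mono grow[OF t])
      have "- V (\<phi> t v) \<le> B" using B[OF K(2)[OF t]] by linarith
      then have "- V (\<phi> t v) / (2 * D) \<le> B / (2 * D)"
        using D(1) by (intro divide_right_mono) auto
      then show "exp (- V (\<phi> t v) / (2 * D)) \<le> exp (B / (2 * D))" by simp
    qed (simp_all add: f_def q0)
    finally have "c * q t \<le> c * (f 0 * exp ((D - (\<sigma> + 1) - 2 * b) * t) * exp (B / (2 * D)))"
      using k(1) by (intro mult_left_mono) (auto simp: c_def)
    with wq show "(norm (area i j t v))\<^sup>2 \<le> c * f 0 * exp (B / (2 * D)) * exp ((D - (\<sigma> + 1) - 2 * b) * t)"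
      by (simp add: mult_ac)
  qed
qed

text \<open>A semiflow is only assumed to consist of solutions, so uniqueness at the equilibrium has to be
shown: the squared norm satisfies a linear differential inequality, since the quadratic part of the
vector field is orthogonal to the position.\<close>

lemma flow_fixes_origin:
  assumes "t \<ge> 0"
  shows "\<phi> t 0 = 0"
proof -
  define f where "f t = (\<phi> t 0 $ 1)\<^sup>2 + (\<phi> t 0 $ 2)\<^sup>2 + (\<phi> t 0 $ 3)\<^sup>2" for t
  have "f t \<le> f 0 * exp ((\<sigma> + r) * t)"
  proof (rule gronwall_on_half_line[OF _ _ assms])
    fix s :: real assume s: "s \<ge> 0"
    define x y z where "x = \<phi> s 0 $ 1" and "y = \<phi> s 0 $ 2" and "z = \<phi> s 0 $ 3"
    show "(f has_real_derivative 2 * (\<sigma> + r) * x * y - 2 * (\<sigma> * x\<^sup>2 + y\<^sup>2 + b * z\<^sup>2)) (at s within {0..})"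
      unfolding f_def
      by (rule derivative_eq_intros flow_component_derivs[OF s] refl)+
        (simp add: x_def y_def z_def algebra_simps power2_eq_square)
    have "2 * (x * y) \<le> f s"
      using sum_squares_bound[of x y] zero_le_power2[of z]
      unfolding f_def x_def[symmetric] y_def[symmetric] z_def[symmetric] by linarith
    then have "(\<sigma> + r) * (2 * (x * y)) \<le> (\<sigma> + r) * f s"
      using pos by (intro mult_left_mono) auto
    moreover have "0 \<le> 2 * (\<sigma> * x\<^sup>2 + y\<^sup>2 + b * z\<^sup>2)"
      using pos by simp
    moreover have "2 * (\<sigma> + r) * x * y = (\<sigma> + r) * (2 * (x * y))" by simp
    ultimately show "2 * (\<sigma> + r) * x * y - 2 * (\<sigma> * x\<^sup>2 + y\<^sup>2 + b * z\<^sup>2) \<le> (\<sigma> + r) * f s"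
      by linarith
  qed
  moreover have "\<phi> 0 0 = 0" using flow by (simp add: solution_semiflow_def)
  ultimately have "f t \<le> 0" by (simp add: f_def)
  then have "(\<phi> t 0 $ 1)\<^sup>2 = 0" "(\<phi> t 0 $ 2)\<^sup>2 = 0" "(\<phi> t 0 $ 3)\<^sup>2 = 0"
    using zero_le_power2[of "\<phi> t 0 $ 1"] zero_le_power2[of "\<phi> t 0 $ 2"] zero_le_power2[of "\<phi> t 0 $ 3"]
    unfolding f_def by linarith+
  then show ?thesis by (simp add: vec_eq_iff forall_3)
qed

text \<open>At the equilibrium the linearization has constant coefficients, and
\<open>(\<sigma>, \<mu> + \<sigma>, 0)\<close> is an eigenvector of \<open>J 0\<close> for the eigenvalue \<open>\<mu>\<close>. The inner product of the area
vector with it grows exactly at the rate \<open>trace (J 0) - \<mu>\<close>, which is the sum of the other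
two eigenvalues.\<close>

lemma area_growth_at_origin:
  fixes D :: real
  assumes D: "D\<^sup>2 = (\<sigma> - 1)\<^sup>2 + 4 * \<sigma> * r" and t: "t \<ge> 0"
  defines "\<mu> \<equiv> - (\<sigma> + 1 + D) / 2"
  shows "\<sigma>\<^sup>2 * exp ((D - (\<sigma> + 1) - 2 * b) * t) \<le> (\<sigma>\<^sup>2 + (\<mu> + \<sigma>)\<^sup>2) * (norm (area 2 3 t 0))\<^sup>2"
proof -
  define \<kappa> where "\<kappa> = (D - (\<sigma> + 1)) / 2 - b"
  define g where "g t = \<sigma> * area 2 3 t 0 $ 1 + (\<mu> + \<sigma>) * area 2 3 t 0 $ 2" for t
  have \<mu>: "\<sigma> * r = (1 + \<mu>) * (\<mu> + \<sigma>)"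
  proof -
    have "(1 + \<mu>) * (\<mu> + \<sigma>) = (D\<^sup>2 - (\<sigma> - 1)\<^sup>2) / 4"
      by (simp add: \<mu>_def field_simps power2_eq_square)
    then show ?thesis unfolding D by simp
  qed
  have \<kappa>: "\<kappa> = - (1 + b) - \<mu> - \<sigma>" by (simp add: \<kappa>_def \<mu>_def field_simps)
  have g: "g t = g 0 * exp (\<kappa> * t)"
  proof (rule linear_ode_on_half_line[OF _ t])
    fix s :: real assume s: "s \<ge> 0"
    define w1 w2 where "w1 = area 2 3 s 0 $ 1" and "w2 = area 2 3 s 0 $ 2"
    have "(g has_real_derivative \<sigma> * (- (1 + b) * w1 - r * w2) + (\<mu> + \<sigma>) * (- \<sigma> * w1 - (\<sigma> + b) * w2))
        (at s within {0..})"
      using DERIV_add[OF DERIV_cmult[OF area_component_derivs(1)[OF s, of 2 3 0], of \<sigma>]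
          DERIV_cmult[OF area_component_derivs(2)[OF s, of 2 3 0], of "\<mu> + \<sigma>"]]
      unfolding flow_fixes_origin[OF s] g_def w1_def w2_def by simp
    moreover have "\<sigma> * (- (1 + b) * w1 - r * w2) + (\<mu> + \<sigma>) * (- \<sigma> * w1 - (\<sigma> + b) * w2) = \<kappa> * g s"
      unfolding g_def w1_def[symmetric] w2_def[symmetric] \<kappa> using \<mu> by algebra
    ultimately show "(g has_real_derivative \<kappa> * g s) (at s within {0..})" by simp
  qed
  have "X 0 0 = mat 1" using fundamental by (simp add: fundamental_matrix_def)
  then have "g 0 = \<sigma>"
    by (simp add: g_def area_def cross3_def column_def mat_def)
  with g have "\<sigma>\<^sup>2 * exp ((D - (\<sigma> + 1) - 2 * b) * t) = (g t)\<^sup>2"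
    by (simp add: power_mult_distrib \<kappa>_def field_simps flip: exp_double)
  also have "\<dots> \<le> (\<sigma>\<^sup>2 + (\<mu> + \<sigma>)\<^sup>2) * ((area 2 3 t 0 $ 1)\<^sup>2 + (area 2 3 t 0 $ 2)\<^sup>2)"
  proof -
    have "(\<sigma>\<^sup>2 + (\<mu> + \<sigma>)\<^sup>2) * ((area 2 3 t 0 $ 1)\<^sup>2 + (area 2 3 t 0 $ 2)\<^sup>2) - (g t)\<^sup>2
       = (\<sigma> * area 2 3 t 0 $ 2 - (\<mu> + \<sigma>) * area 2 3 t 0 $ 1)\<^sup>2"
      unfolding g_def by algebra
    then show ?thesis
      using zero_le_power2[of "\<sigma> * area 2 3 t 0 $ 2 - (\<mu> + \<sigma>) * area 2 3 t 0 $ 1"] by linarith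
  qed
  also have "\<dots> \<le> (\<sigma>\<^sup>2 + (\<mu> + \<sigma>)\<^sup>2) * (norm (area 2 3 t 0))\<^sup>2"
    by (intro mult_left_mono, simp only: power2_norm_eq_inner)
      (simp_all add: inner_vec_def sum_3 power2_eq_square)
  finally show ?thesis .
qed

lemma local_lyapunov_dim_le:
  fixes \<kappa> :: real
  assumes \<kappa>: "\<kappa> > 0"
    and growth: "\<And>i j. \<exists>C. \<forall>t\<ge>0. (norm (area i j t v))\<^sup>2 \<le> C * exp (2 * \<kappa> * t)"
  shows "local_lyapunov_dim X v \<le> ereal (2 + \<kappa> / (\<sigma> + 1 + b + \<kappa>))"
proof -
  obtain C1 C2 C3 where C:
    "\<And>t. t \<ge> 0 \<Longrightarrow> (norm (area 1 2 t v))\<^sup>2 \<le> C1 * exp (2 * \<kappa> * t)"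
    "\<And>t. t \<ge> 0 \<Longrightarrow> (norm (area 2 3 t v))\<^sup>2 \<le> C2 * exp (2 * \<kappa> * t)"
    "\<And>t. t \<ge> 0 \<Longrightarrow> (norm (area 3 1 t v))\<^sup>2 \<le> C3 * exp (2 * \<kappa> * t)"
    using growth by metis
  define C where "C = sqrt \<bar>C1 + C2 + C3\<bar>"
  show ?thesis
  proof (rule local_lyapunov_dim_le_3[where C = C])
    fix t :: real assume "t > 0"
    then have t: "t \<ge> 0" by simp
    obtain s1 s2 s3 where s: "singular_values (X t v) = [s1, s2, s3]" "s1 \<ge> s2" "s2 \<ge> s3" "s3 \<ge> 0"
      "s1 * s2 * s3 = exp (- (\<sigma> + 1 + b) * t)"
      "(s1 * s2)\<^sup>2 \<le> (norm (area 1 2 t v))\<^sup>2 + (norm (area 2 3 t v))\<^sup>2 + (norm (area 3 1 t v))\<^sup>2"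
      by (rule singular_values_fundamental[OF t, of v])
    have "(s1 * s2)\<^sup>2 \<le> (C1 + C2 + C3) * exp (2 * \<kappa> * t)"
      using s(6) C[OF t] unfolding distrib_right by linarith
    also have "\<dots> \<le> \<bar>C1 + C2 + C3\<bar> * exp (2 * \<kappa> * t)"
      by (intro mult_right_mono) auto
    also have "\<dots> = (C * exp (\<kappa> * t))\<^sup>2"
      by (simp add: C_def power_mult_distrib mult.assoc flip: exp_double)
    finally have "s1 * s2 \<le> C * exp (\<kappa> * t)"
      by (rule power2_le_imp_le) (simp add: C_def)
    with s show "\<exists>s1 s2 s3. singular_values (X t v) = [s1, s2, s3] \<and> s1 \<ge> s2 \<and> s2 \<ge> s3
       \<and> s3 \<ge> 0 \<and> s1 * s2 * s3 = exp (- (\<sigma> + 1 + b) * t) \<and> s1 * s2 \<le> C * exp (\<kappa> * t)"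
      by blast
  qed (use pos \<kappa> in auto)
qed

lemma local_lyapunov_dim_ge:
  fixes \<kappa> c1 c2 :: real
  assumes \<kappa>: "\<kappa> > 0" and c: "c1 > 0" "c2 > 0"
    and growth: "\<And>t. t \<ge> 0 \<Longrightarrow> c1 * exp (2 * \<kappa> * t) \<le> c2 * (norm (area 2 3 t v))\<^sup>2"
  shows "ereal (2 + \<kappa> / (\<sigma> + 1 + b + \<kappa>)) \<le> local_lyapunov_dim X v"
proof (rule local_lyapunov_dim_ge_3[where C = "sqrt (c1 / (3 * c2))"])
  fix t :: real assume "t > 0"
  then have t: "t \<ge> 0" by simp
  obtain s1 s2 s3 where s: "singular_values (X t v) = [s1, s2, s3]" "s1 \<ge> s2" "s2 \<ge> s3" "s3 \<ge> 0"
    "s1 * s2 * s3 = exp (- (\<sigma> + 1 + b) * t)" "(norm (area 2 3 t v))\<^sup>2 \<le> 3 * (s1 * s2)\<^sup>2"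
    by (rule singular_values_fundamental[OF t, of v])
  have "c1 * exp (2 * \<kappa> * t) \<le> c2 * (3 * (s1 * s2)\<^sup>2)"
    using growth[OF t] mult_left_mono[OF s(6), of c2] c by linarith
  then have "c1 / (3 * c2) * exp (2 * \<kappa> * t) \<le> (s1 * s2)\<^sup>2"
    using c by (simp add: field_simps)
  moreover have "(sqrt (c1 / (3 * c2)) * exp (\<kappa> * t))\<^sup>2 = c1 / (3 * c2) * exp (2 * \<kappa> * t)"
    using c by (simp add: power_mult_distrib mult.assoc flip: exp_double)
  ultimately have "(sqrt (c1 / (3 * c2)) * exp (\<kappa> * t))\<^sup>2 \<le> (s1 * s2)\<^sup>2" by linarith
  then have "sqrt (c1 / (3 * c2)) * exp (\<kappa> * t) \<le> s1 * s2"
    by (rule power2_le_imp_le) (use s(2-4) in simp)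
  with s show "\<exists>s1 s2 s3. singular_values (X t v) = [s1, s2, s3] \<and> s1 \<ge> s2 \<and> s2 \<ge> s3
     \<and> s3 \<ge> 0 \<and> s1 * s2 * s3 = exp (- (\<sigma> + 1 + b) * t)
     \<and> sqrt (c1 / (3 * c2)) * exp (\<kappa> * t) \<le> s1 * s2"
    by blast
qed (use pos \<kappa> c in auto)

text \<open>The orbit of the equilibrium is constant, so its distance to the closed set \<open>K\<close> can only tend to
zero by being zero.\<close>

lemma origin_in_attractor:
  assumes "global_attractor \<phi> K"
  shows "0 \<in> K"
proof -
  have "((\<lambda>t. infdist (\<phi> t 0) K) \<longlongrightarrow> 0) at_top"
    using assms by (simp add: global_attractor_def globally_attractive_def)
  moreover have "eventually (\<lambda>t. infdist (\<phi> t 0) K = infdist 0 K) at_top"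
    using eventually_ge_at_top[of 0] by eventually_elim (simp add: flow_fixes_origin)
  ultimately have "((\<lambda>_. infdist 0 K) \<longlongrightarrow> 0) (at_top :: real filter)"
    by (rule Lim_transform_eventually)
  then have "infdist 0 K = 0"
    using tendsto_unique[OF trivial_limit_at_top_linorder tendsto_const] by blast
  then show ?thesis
    using assms in_closed_iff_infdist_zero by (auto simp: global_attractor_def)
qed

end

theorem theorem4:
  fixes \<sigma> r b :: real
    and \<phi> :: "real \<Rightarrow> real^3 \<Rightarrow> real^3"
    and X :: "real \<Rightarrow> real^3 \<Rightarrow> real^3^3"
    and K :: "(real^3) set"
  assumes "\<sigma> > 0" and "r > 0" and "b > 0"
    and "solution_semiflow (lorenz \<sigma> r b) \<phi>"
    and "fundamental_matrix (lorenz \<sigma> r b) \<phi> X"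
    and "global_attractor \<phi> K"
    and "r - 1 > 0"
    and "r - 1 \<ge> (b * (b + \<sigma> - 1)^2 - 4 * \<sigma> * (b + \<sigma> * b - b^2)) / (3 * \<sigma>^2)"
    and "\<sigma>^2 * (r - 1) * (b - 4) \<le> 4 * \<sigma> * (\<sigma> * b + b - b^2) - b * (b + \<sigma> - 1)^2
       \<or> (\<sigma>^2 * (r - 1) * (b - 4) > 4 * \<sigma> * (\<sigma> * b + b - b^2) - b * (b + \<sigma> - 1)^2
          \<and> (\<exists>\<gamma>1 \<gamma>2 :: real. \<gamma>1 < \<gamma>2 \<and>
               {\<gamma>. (2 * \<sigma> - b + \<gamma>)^2
                      * (b * (b + \<sigma> - 1)^2 - 4 * \<sigma> * (\<sigma> * b + b - b^2) + \<sigma>^2 * (r - 1) * (b - 4))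
                    + 4 * b * \<gamma> * (\<sigma> + 1)
                      * (b * (b + \<sigma> - 1)^2 - 4 * \<sigma> * (\<sigma> * b + b - b^2) - 3 * \<sigma>^2 * (r - 1)) = 0}
                 = {\<gamma>1, \<gamma>2} \<and>
               \<gamma>2 > 0))"
    and "\<sigma> * r > (b + 1) * (b + \<sigma>)"
  shows "lyapunov_dim X K
           = ereal (3 - 2 * (\<sigma> + b + 1) / (\<sigma> + 1 + sqrt ((\<sigma> - 1)^2 + 4 * \<sigma> * r)))"
proof -
  interpret lorenz_flow \<sigma> r b \<phi> X
    using assms by unfold_locales
  define D where "D = sqrt ((\<sigma> - 1)\<^sup>2 + 4 * \<sigma> * r)"
  define \<kappa> where "\<kappa> = (D - (\<sigma> + 1)) / 2 - b"
  define N where "N = \<sigma> * r + (b - 1) * (\<sigma> - b)"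
  define A where "A = b * (b + \<sigma> - 1)\<^sup>2 - 4 * \<sigma> * (\<sigma> * b + b - b\<^sup>2)"
  have D2: "D\<^sup>2 = (\<sigma> - 1)\<^sup>2 + 4 * \<sigma> * r"
    using pos by (simp add: D_def add_nonneg_nonneg)
  have "(2 * b + \<sigma> + 1)\<^sup>2 < D\<^sup>2"
  proof -
    have "D\<^sup>2 - (2 * b + \<sigma> + 1)\<^sup>2 = 4 * (\<sigma> * r - (b + 1) * (b + \<sigma>))"
      unfolding D2 by algebra
    moreover have "0 < 4 * (\<sigma> * r - (b + 1) * (b + \<sigma>))" using assms(10) by simp
    ultimately have "0 < D\<^sup>2 - (2 * b + \<sigma> + 1)\<^sup>2" by (simp only:)
    then show ?thesis by simp
  qed
  then have D_gt: "2 * b + \<sigma> + 1 < D"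
    by (rule power2_less_imp_less) (use pos in \<open>simp add: D_def\<close>)
  then have D0: "D > 0" and \<kappa>: "\<kappa> > 0" using pos by (auto simp: \<kappa>_def)
  have rate: "D - (\<sigma> + 1) - 2 * b = 2 * \<kappa>" by (simp add: \<kappa>_def)
  have N: "N > 0"
  proof -
    have "N = (\<sigma> * r - (b + 1) * (b + \<sigma>)) + (2 * b * \<sigma> + 2 * b)"
      unfolding N_def by algebra
    moreover have "2 * b * \<sigma> + 2 * b > 0" using pos by (simp add: add_pos_pos)
    moreover have "\<sigma> * r - (b + 1) * (b + \<sigma>) > 0" using assms(10) by simp
    ultimately show ?thesis by (simp only: add_pos_pos)
  qed
  have dim: "2 + \<kappa> / (\<sigma> + 1 + b + \<kappa>) = 3 - 2 * (\<sigma> + b + 1) / (\<sigma> + 1 + D)"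
  proof -
    have sum: "\<sigma> + 1 + b + \<kappa> = (\<sigma> + 1 + D) / 2" by (simp add: \<kappa>_def field_simps)
    have "\<kappa> / (\<sigma> + 1 + b + \<kappa>) = 2 * \<kappa> / (\<sigma> + 1 + D)" unfolding sum by simp
    also have "2 * \<kappa> = (\<sigma> + 1 + D) - 2 * (\<sigma> + b + 1)" by (simp add: \<kappa>_def field_simps)
    also have "\<dots> / (\<sigma> + 1 + D) = 1 - 2 * (\<sigma> + b + 1) / (\<sigma> + 1 + D)"
      using D0 pos by (subst diff_divide_distrib) simp
    finally show ?thesis by linarith
  qed
  obtain \<alpha> \<beta> \<delta> \<epsilon> \<zeta> \<eta> \<theta> where lyap:
    "\<And>x y z. (4 * \<alpha> * x^3 + 2 * \<beta> * x * z + \<zeta> * y + 2 * \<eta> * x) * (\<sigma> * (y - x))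
       + (2 * \<delta> * y + \<zeta> * x) * (r * x - y - x * z)
       + (\<beta> * x\<^sup>2 + 2 * \<epsilon> * z + \<theta>) * (- b * z + x * y)
       + (\<sigma>\<^sup>2 / N * z\<^sup>2 - 4 * \<sigma> * z + \<sigma>\<^sup>2 / N * (y + (b - 1) / \<sigma> * x)\<^sup>2) \<le> 0"
  proof (rule lorenz_lyapunov_function[of \<sigma> b r, folded A_def N_def])
    show "\<sigma> > 0" "b > 0" "r > 1" "N > 0" using pos N assms(7) by auto
    have "b * (b + \<sigma> - 1)\<^sup>2 - 4 * \<sigma> * (b + \<sigma> * b - b\<^sup>2) = A" by (simp add: A_def algebra_simps)
    then show "A \<le> 3 * \<sigma>\<^sup>2 * (r - 1)"
      using assms(8) pos by (simp add: pos_divide_le_eq mult.commute)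
    show "A + \<sigma>\<^sup>2 * (r - 1) * (b - 4) \<le> 0 \<or>
      (\<exists>g>0. (2 * \<sigma> - b + g)\<^sup>2 * (A + \<sigma>\<^sup>2 * (r - 1) * (b - 4))
         + 4 * b * g * (\<sigma> + 1) * (A - 3 * \<sigma>\<^sup>2 * (r - 1)) = 0)"
      using assms(9)
    proof (elim disjE conjE exE)
      assume "\<sigma>\<^sup>2 * (r - 1) * (b - 4) \<le> 4 * \<sigma> * (\<sigma> * b + b - b\<^sup>2) - b * (b + \<sigma> - 1)\<^sup>2"
      then show ?thesis by (simp add: A_def)
    next
      fix \<gamma>1 \<gamma>2 :: real
      assume g: "\<gamma>2 > 0" and roots: "{\<gamma>. (2 * \<sigma> - b + \<gamma>)^2
                      * (b * (b + \<sigma> - 1)^2 - 4 * \<sigma> * (\<sigma> * b + b - b^2) + \<sigma>^2 * (r - 1) * (b - 4))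
                    + 4 * b * \<gamma> * (\<sigma> + 1)
                      * (b * (b + \<sigma> - 1)^2 - 4 * \<sigma> * (\<sigma> * b + b - b^2) - 3 * \<sigma>^2 * (r - 1)) = 0}
                 = {\<gamma>1, \<gamma>2}"
      have "\<gamma>2 \<in> {\<gamma>1, \<gamma>2}" by simp
      from this[folded roots, unfolded mem_Collect_eq, folded A_def] g show ?thesis by blast
    qed
  qed (rule that)
  have "local_lyapunov_dim X v \<le> ereal (2 + \<kappa> / (\<sigma> + 1 + b + \<kappa>))" if v: "v \<in> K" for v
  proof (rule local_lyapunov_dim_le[OF \<kappa>])
    fix i j
    have K: "compact K"
      using assms(6) by (simp add: global_attractor_def compact_eq_bounded_closed)
    have orbit: "\<phi> t v \<in> K" if "t \<ge> 0" for t
      using assms(6) v that by (auto simp: global_attractor_def invariant_set_def)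
    have k: "\<sigma>\<^sup>2 / N > 0" "\<sigma>\<^sup>2 / N * (\<sigma> * r + (b - 1) * (\<sigma> - b)) = \<sigma>\<^sup>2"
      and m: "\<sigma> * ((b - 1) / \<sigma>) = b - 1"
      using N pos by (simp_all flip: N_def)
    show "\<exists>C. \<forall>t\<ge>0. (norm (area i j t v))\<^sup>2 \<le> C * exp (2 * \<kappa> * t)"
      using area_growth_on_bounded_orbit[where i = i and j = j, OF K orbit k m D0 D2 lyap]
      unfolding rate .
  qed
  moreover have "ereal (2 + \<kappa> / (\<sigma> + 1 + b + \<kappa>)) \<le> local_lyapunov_dim X 0"
  proof (rule local_lyapunov_dim_ge[OF \<kappa>])
    show "\<sigma>\<^sup>2 > 0" "\<sigma>\<^sup>2 + (- (\<sigma> + 1 + D) / 2 + \<sigma>)\<^sup>2 > 0"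
      using pos by (simp_all add: add_pos_nonneg)
    show "\<sigma>\<^sup>2 * exp (2 * \<kappa> * t) \<le> (\<sigma>\<^sup>2 + (- (\<sigma> + 1 + D) / 2 + \<sigma>)\<^sup>2) * (norm (area 2 3 t 0))\<^sup>2"
      if "t \<ge> 0" for t
      using area_growth_at_origin[OF D2 that] unfolding rate .
  qed
  ultimately have "lyapunov_dim X K = ereal (2 + \<kappa> / (\<sigma> + 1 + b + \<kappa>))"
    unfolding lyapunov_dim_def
    by (intro antisym SUP_least SUP_upper2[OF origin_in_attractor[OF assms(6)]])
  then show ?thesis unfolding dim D_def .
qed

end
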